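(* Let $\Omega\subseteq\mathbb{H}^n$ be a domain and $u_1,\dots,u_n\in C^2(\Omega)$. Then $$\begin{aligned}\triangle u_1\wedge\triangle u_2\wedge\dots\wedge\triangle u_n&=d_0(d_1u_1\wedge\triangle u_2\wedge\dots\wedge\triangle u_n)=-d_1(d_0u_1\wedge\triangle u_2\wedge\dots\wedge\triangle u_n)\\&=d_0d_1(u_1\triangle u_2\wedge\dots\wedge\triangle u_n)=\triangle(u_1\triangle u_2\wedge\dots\wedge\triangle u_n),\end{aligned}$$ where derivatives of coefficients that are not classically differentiable are taken in the sense of distributions.
   Context: Points of $\mathbb{H}^n\cong\mathbb{R}^{4n}$ are $q=(q_0,\dots,q_{n-1})$, $q_l=x_{4l}+\mathbf{i}x_{4l+1}+\mathbf{j}x_{4l+2}+\mathbf{k}x_{4l+3}$. Define complex first-order differential operators $\nabla_{j\alpha}$, $j=0,\dots,2n-1$, $\alpha=0,1$, by (here $\mathbf{i}$ is the imaginary unit of $\mathbb{C}$), for $l=0,\dots,n-1$: $\nabla_{(2l)0}=\partial_{x_{4l}}+\mathbf{i}\partial_{x_{4l+1}}$, $\nabla_{(2l)1}=-\partial_{x_{4l+2}}-\mathbf{i}\partial_{x_{4l+3}}$, $\nabla_{(2l+1)0}=\partial_{x_{4l+2}}-\mathbf{i}\partial_{x_{4l+3}}$, $\nabla_{(2l+1)1}=\partial_{x_{4l}}-\mathbf{i}\partial_{x_{4l+1}}$. Fix a basis $\{\omega^0,\dots,\omega^{2n-1}\}$ of $\mathbb{C}^{2n}$, $\omega^I=\omega^{i_1}\wedge\dots\wedge\omega^{i_p}$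 for $I=(i_1,\dots,i_p)$. For $F=\sum_I f_I\omega^I$ with values in $\wedge^p\mathbb{C}^{2n}$, define $d_\alpha F=\sum_{k,I}\nabla_{k\alpha}f_I\,\omega^k\wedge\omega^I$, $\alpha=0,1$ (with distributional derivatives of the coefficients when needed), and $\triangle F=d_0d_1F$. *)

theory Defs
  imports "HOL-Analysis.Analysis"
begin

text \<open>
  Quaternionic space of dimension \<open>n = CARD('n)\<close> is modelled as \<open>real ^ 4 ^ 'n\<close>; the linear
  order on the index type numbers the quaternionic coordinates \<open>0, \<dots>, n - 1\<close>, and \<open>xdir m\<close> is the
  unit vector of the real coordinate with number \<open>m < 4 * n\<close>.
\<close>

type_synonym 'n hspace = "real ^ 4 ^ 'n"

definition xdir :: "nat \<Rightarrow> 'n::{finite,linorder} hspace" where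
  "xdir m = axis (sorted_list_of_set UNIV ! (m div 4)) (axis (of_nat (Suc (m mod 4))) 1)"

definition xderiv :: "nat \<Rightarrow> ('n::{finite,linorder} hspace \<Rightarrow> complex) \<Rightarrow> 'n hspace \<Rightarrow> complex" where
  "xderiv m f q = frechet_derivative f (at q) (xdir m)"

text \<open>Membership in \<open>C\<^sup>k(\<Omega>)\<close>; only meaningful for open \<open>\<Omega>\<close>.\<close>

primrec C_on :: "nat \<Rightarrow> 'n::{finite,linorder} hspace set \<Rightarrow> ('n hspace \<Rightarrow> complex) \<Rightarrow> bool" where
  "C_on 0 \<Omega> f \<longleftrightarrow> continuous_on \<Omega> f"
| "C_on (Suc k) \<Omega> f \<longleftrightarrow>
     (\<forall>q\<in>\<Omega>. f differentiable (at q)) \<and> (\<forall>m<4 * CARD('n). C_on k \<Omega> (xderiv m f))"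

text \<open>
  \<open>nabla_comb j \<alpha> D\<close> is the linear combination of first-order partial derivatives making up the
  operator with indices \<open>j\<close> and \<open>\<alpha> \<in> {0, 1}\<close>, where \<open>D m\<close> is the partial derivative in the
  \<open>m\<close>-th real coordinate. It is used both for functions and for distributions.
\<close>

definition nabla_comb :: "nat \<Rightarrow> nat \<Rightarrow> (nat \<Rightarrow> complex) \<Rightarrow> complex" where
  "nabla_comb j \<alpha> D =
     (let l = j div 2 in
      if even j then
        (if \<alpha> = 0 then D (4 * l) + \<i> * D (4 * l + 1)
         else - D (4 * l + 2) - \<i> * D (4 * l + 3))
      else
        (if \<alpha> = 0 then D (4 * l + 2) - \<i> * D (4 * l + 3)
         else D (4 * l) - \<i> * D (4 * l + 1)))"

definition nabla :: "nat \<Rightarrow> nat \<Rightarrow> ('n::{finite,linorder} hspace \<Rightarrow> complex) \<Rightarrow> 'n hspace \<Rightarrow> complex" where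
  "nabla j \<alpha> f q = nabla_comb j \<alpha> (\<lambda>m. xderiv m f q)"

text \<open>
  An element of the exterior algebra on the basis vectors numbered by natural numbers is given by
  its coefficients with respect to the basis \<open>\<omega>\<^sup>I\<close>, where the strictly increasing multi-index \<open>I\<close> is
  identified with the set of its entries. The sign \<open>ext_sign I J\<close> is that of the permutation sorting
  the concatenation of \<open>I\<close> and \<open>J\<close>, so that \<open>\<omega>\<^sup>I \<and> \<omega>\<^sup>J = ext_sign I J \<cdot> \<omega>\<^sup>K\<close> with \<open>K = I \<union> J\<close>
  for disjoint \<open>I\<close>, \<open>J\<close>.
\<close>

type_synonym ext = "nat set \<Rightarrow> complex"

definition omega :: "nat set \<Rightarrow> ext" where
  "omega I = (\<lambda>K. if K = I then 1 else 0)"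

definition ext_sign :: "nat set \<Rightarrow> nat set \<Rightarrow> complex" where
  "ext_sign I J = (- 1) ^ card {(i, j). i \<in> I \<and> j \<in> J \<and> j < i}"

definition ext_wedge :: "ext \<Rightarrow> ext \<Rightarrow> ext" where
  "ext_wedge a b = (\<lambda>K. \<Sum>I\<in>Pow K. ext_sign I (K - I) * a I * b (K - I))"

type_synonym 'n form = "'n hspace \<Rightarrow> ext"

definition form_of_fun :: "('n::{finite,linorder} hspace \<Rightarrow> complex) \<Rightarrow> 'n form" where
  "form_of_fun f = (\<lambda>q K. f q * omega {} K)"

definition wedge :: "'n::{finite,linorder} form \<Rightarrow> 'n form \<Rightarrow> 'n form"  (infixr "\<and>\<^sub>f" 70) where
  "F \<and>\<^sub>f G = (\<lambda>q. ext_wedge (F q) (G q))"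

definition wedge_list :: "'n::{finite,linorder} form list \<Rightarrow> 'n form" where
  "wedge_list Fs = foldr wedge Fs (form_of_fun (\<lambda>_. 1))"

definition scale_form :: "('n::{finite,linorder} hspace \<Rightarrow> complex) \<Rightarrow> 'n form \<Rightarrow> 'n form"
    (infixr "\<cdot>\<^sub>f" 75) where
  "f \<cdot>\<^sub>f F = (\<lambda>q K. f q * F q K)"

definition dform :: "nat \<Rightarrow> 'n::{finite,linorder} form \<Rightarrow> 'n form" where
  "dform \<alpha> F = (\<lambda>q K. \<Sum>k<2 * CARD('n). \<Sum>I\<in>Pow {..<2 * CARD('n)}.
     nabla k \<alpha> (\<lambda>q. F q I) q * ext_wedge (omega {k}) (omega I) K)"

text \<open>
  \<open>dform\<close> and \<open>triangle_form\<close> use classical derivatives; their counterparts acting on distribution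
  coefficients are \<open>dist_dform\<close> and \<open>dist_triangle\<close>.
\<close>

definition triangle_form :: "('n::{finite,linorder} hspace \<Rightarrow> complex) \<Rightarrow> 'n form" where
  "triangle_form u = dform 0 (dform 1 (form_of_fun u))"

definition test_functions :: "'n::{finite,linorder} hspace set \<Rightarrow> ('n hspace \<Rightarrow> complex) set" where
  "test_functions \<Omega> = {\<phi>. (\<forall>k. C_on k UNIV \<phi>) \<and>
     compact (closure {q. \<phi> q \<noteq> 0}) \<and> closure {q. \<phi> q \<noteq> 0} \<subseteq> \<Omega>}"

text \<open>
  Distributions are represented as functionals on complex-valued functions, of which only the values
  on \<open>test_functions \<Omega>\<close> matter: two forms are compared on \<open>\<Omega>\<close> by \<open>dist_form_eq \<Omega>\<close>.
\<close>

type_synonym 'n distr = "('n hspace \<Rightarrow> complex) \<Rightarrow> complex"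

type_synonym 'n dist_form = "nat set \<Rightarrow> 'n distr"

definition dist_of_fun ::
    "'n::{finite,linorder} hspace set \<Rightarrow> ('n hspace \<Rightarrow> complex) \<Rightarrow> 'n distr" where
  "dist_of_fun \<Omega> f = (\<lambda>\<phi>. LINT q:\<Omega>|lborel. f q * \<phi> q)"

definition dist_xderiv :: "nat \<Rightarrow> 'n::{finite,linorder} distr \<Rightarrow> 'n distr" where
  "dist_xderiv m T = (\<lambda>\<phi>. - T (xderiv m \<phi>))"

definition dist_nabla :: "nat \<Rightarrow> nat \<Rightarrow> 'n::{finite,linorder} distr \<Rightarrow> 'n distr" where
  "dist_nabla j \<alpha> T = (\<lambda>\<phi>. nabla_comb j \<alpha> (\<lambda>m. dist_xderiv m T \<phi>))"

definition dist_of_form :: "'n::{finite,linorder} hspace set \<Rightarrow> 'n form \<Rightarrow> 'n dist_form" where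
  "dist_of_form \<Omega> F = (\<lambda>K. dist_of_fun \<Omega> (\<lambda>q. F q K))"

definition dist_dform :: "nat \<Rightarrow> 'n::{finite,linorder} dist_form \<Rightarrow> 'n dist_form" where
  "dist_dform \<alpha> T = (\<lambda>K \<phi>. \<Sum>k<2 * CARD('n). \<Sum>I\<in>Pow {..<2 * CARD('n)}.
     dist_nabla k \<alpha> (T I) \<phi> * ext_wedge (omega {k}) (omega I) K)"

definition dist_triangle :: "'n::{finite,linorder} dist_form \<Rightarrow> 'n dist_form" where
  "dist_triangle T = dist_dform 0 (dist_dform 1 T)"

definition dist_uminus :: "'n::{finite,linorder} dist_form \<Rightarrow> 'n dist_form" where
  "dist_uminus T = (\<lambda>K \<phi>. - T K \<phi>)"

definition dist_form_eq ::
    "'n::{finite,linorder} hspace set \<Rightarrow> 'n dist_form \<Rightarrow> 'n dist_form \<Rightarrow> bool" where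
  "dist_form_eq \<Omega> S T \<longleftrightarrow> (\<forall>K. \<forall>\<phi>\<in>test_functions \<Omega>. S K \<phi> = T K \<phi>)"

end

theory Submission
  imports Defs
begin

text \<open>
  Put \<open>E\<^sub>k a = \<omega>\<^sup>k \<and> a\<close>, so that \<open>d\<^sub>\<alpha> = \<Sum>\<^sub>k E\<^sub>k \<nabla>\<^sub>k\<^sub>\<alpha>\<close>. The operators \<open>E\<^sub>k\<close> anticommute and the \<open>\<nabla>\<^sub>k\<^sub>\<alpha>\<close>
  commute on \<open>C\<^sup>2\<close> functions, so \<open>d\<^sub>0 d\<^sub>0 = d\<^sub>1 d\<^sub>1 = 0\<close> and \<open>d\<^sub>0 d\<^sub>1 = - d\<^sub>1 d\<^sub>0\<close>. If everything were smooth,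
  \<open>W = \<triangle>u\<^sub>2 \<and> \<dots> \<and> \<triangle>u\<^sub>n\<close> would be closed under \<open>d\<^sub>0\<close> and \<open>d\<^sub>1\<close>, and all the identities would be
  instances of the product rule \<open>d\<^sub>\<alpha>(f W) = d\<^sub>\<alpha> f \<and> W\<close>.

  For \<open>u\<^sub>i \<in> C\<^sup>2\<close> the coefficients of \<open>W\<close> are merely continuous, and the products that occur are of a
  \<open>C\<^sup>1\<close> function \<open>f\<close> with such a \<open>W\<close>. The way out is to test closedness of \<open>W\<close> against compactly
  supported functions \<open>\<phi>\<close> of class \<open>C\<^sup>1\<close> (\<open>weakly_closed\<close>). Then \<open>f \<phi>\<close> is again an admissible
  test function, and the product rule for \<open>f W\<close> (\<open>dist_dform_scale\<close>) is the ordinary product rule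
  for \<open>f \<phi>\<close> under the integral sign. It yields \<open>d\<^sub>\<alpha>(d\<^sub>\<beta> u \<and> W) = d\<^sub>\<alpha> d\<^sub>\<beta> u \<and> W\<close> for \<open>u \<in> C\<^sup>2\<close>
  (\<open>dist_dform_dform_fun_wedge\<close>), which is the first identity; the second one is the first together
  with \<open>d\<^sub>0 d\<^sub>1 u = - d\<^sub>1 d\<^sub>0 u\<close>, and the third one applies the product rule once more, to \<open>f = u\<^sub>1\<close>.

  It remains to see that \<open>W\<close> is closed in this sense, by induction on the number of factors. For a
  test function \<open>\<phi>\<close> of class \<open>C\<^sup>2\<close>, the pairing of \<open>d\<^sub>\<alpha>(d\<^sub>\<alpha> d\<^sub>\<beta> u \<and> W) = d\<^sub>\<alpha> d\<^sub>\<alpha>(d\<^sub>\<beta> u \<and> W)\<close> with \<open>\<phi>\<close> is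
  a sum over \<open>E\<^sub>k E\<^sub>j\<close> and \<open>\<nabla>\<^sub>j\<^sub>\<alpha> \<nabla>\<^sub>k\<^sub>\<alpha> \<phi>\<close>, which vanishes by antisymmetry. To reach test functions of
  class \<open>C\<^sup>1\<close>, mollify \<open>\<phi>\<close>: the mollified functions are of class \<open>C\<^sup>2\<close>, their supports stay in one
  compact subset of \<open>\<Omega>\<close>, and their first derivatives converge boundedly
  (\<open>C_c_1_weak_approximation\<close>). The empty product is closed because the integral of a derivative of
  a compactly supported function is zero.
\<close>

section \<open>Exterior algebra\<close>

lemma ext_sign_union_left:
  assumes "finite A" "finite B" "finite C" "A \<inter> B = {}"
  shows "ext_sign (A \<union> B) C = ext_sign A C * ext_sign B C"
proof -
  have "{(i, j). i \<in> A \<union> B \<and> j \<in> C \<and> j < i} =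
      {(i, j). i \<in> A \<and> j \<in> C \<and> j < i} \<union> {(i, j). i \<in> B \<and> j \<in> C \<and> j < i}"
    by auto
  moreover have "finite {(i, j). i \<in> X \<and> j \<in> C \<and> j < i}" if "finite X" for X :: "nat set"
    by (rule finite_subset[of _ "X \<times> C"]) (use that assms in auto)
  ultimately have "card {(i, j). i \<in> A \<union> B \<and> j \<in> C \<and> j < i} =
      card {(i, j). i \<in> A \<and> j \<in> C \<and> j < i} + card {(i, j). i \<in> B \<and> j \<in> C \<and> j < i}"
    using assms by (simp, intro card_Un_disjoint) auto
  then show ?thesis
    by (simp add: ext_sign_def power_add)
qed

lemma ext_sign_union_right:
  assumes "finite A" "finite B" "finite C" "B \<inter> C = {}"
  shows "ext_sign A (B \<union> C) = ext_sign A B * ext_sign A C"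
proof -
  have "{(i, j). i \<in> A \<and> j \<in> B \<union> C \<and> j < i} =
      {(i, j). i \<in> A \<and> j \<in> B \<and> j < i} \<union> {(i, j). i \<in> A \<and> j \<in> C \<and> j < i}"
    by auto
  moreover have "finite {(i, j). i \<in> A \<and> j \<in> X \<and> j < i}" if "finite X" for X :: "nat set"
    by (rule finite_subset[of _ "A \<times> X"]) (use that assms in auto)
  ultimately have "card {(i, j). i \<in> A \<and> j \<in> B \<union> C \<and> j < i} =
      card {(i, j). i \<in> A \<and> j \<in> B \<and> j < i} + card {(i, j). i \<in> A \<and> j \<in> C \<and> j < i}"
    using assms by (simp, intro card_Un_disjoint) auto
  then show ?thesis
    by (simp add: ext_sign_def power_add)
qed

lemma ext_sign_singletons: "ext_sign {i} {j} = (if j < i then -1 else 1)"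
proof -
  have "{(i', j'). i' \<in> {i} \<and> j' \<in> {j} \<and> j' < i'} = (if j < i then {(i, j)} else {})"
    by auto
  then show ?thesis
    by (simp add: ext_sign_def)
qed

lemma ext_sign_insert:
  assumes "finite L" "k \<notin> L"
  shows "ext_sign {j} (insert k L) = (if k < j then -1 else 1) * ext_sign {j} L"
  using ext_sign_union_right[of "{j}" "{k}" L] assms by (simp add: ext_sign_singletons)

text \<open>
  Both sides are sums over the ordered partitions of \<open>K\<close> into three parts \<open>J\<close>, \<open>L\<close>, \<open>N\<close>, with the sign
  that counts the inversions between each of the three pairs of parts.
\<close>

lemma ext_wedge_assoc: "ext_wedge (ext_wedge a b) c = ext_wedge a (ext_wedge b c)"
proof
  fix K
  show "ext_wedge (ext_wedge a b) c K = ext_wedge a (ext_wedge b c) K"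
  proof (cases "finite K")
    case False
    then show ?thesis by (simp add: ext_wedge_def)
  next
    case fin: True
    define G where "G J L N = ext_sign J L * ext_sign J N * ext_sign L N * a J * b L * c N" for J L N
    have left: "ext_sign I (K - I) * (ext_sign J (I - J) * a J * b (I - J)) * c (K - I) =
        G J (I - J) (K - I)" if "I \<in> Pow K" "J \<in> Pow I" for I J
    proof -
      have "finite I" "finite J" and I: "J \<union> (I - J) = I"
        using that fin by (auto intro: finite_subset)
      then have "ext_sign I (K - I) = ext_sign J (K - I) * ext_sign (I - J) (K - I)"
        using ext_sign_union_left[of J "I - J" "K - I"] fin by simp
      then show ?thesis by (simp add: G_def)
    qed
    have right: "ext_sign J (K - J) * a J * (ext_sign L (K - J - L) * b L * c (K - J - L)) =
        G J L (K - J - L)" if "J \<in> Pow K" "L \<in> Pow (K - J)" for J L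
    proof -
      have "finite J" "finite L" and "L \<union> (K - J - L) = K - J"
        using that fin by (auto intro: finite_subset)
      then have "ext_sign J (K - J) = ext_sign J L * ext_sign J (K - J - L)"
        using ext_sign_union_right[of J L "K - J - L"] fin by simp
      then show ?thesis by (simp add: G_def)
    qed
    have fins: "finite (Pow K)" "\<forall>I\<in>Pow K. finite (Pow I)" "\<forall>J\<in>Pow K. finite (Pow (K - J))"
      using fin by (auto intro: finite_subset)
    have "ext_wedge (ext_wedge a b) c K = (\<Sum>I\<in>Pow K. \<Sum>J\<in>Pow I. G J (I - J) (K - I))"
      unfolding ext_wedge_def sum_distrib_left sum_distrib_right
      by (intro sum.cong refl left)
    also have "\<dots> = (\<Sum>(I, J)\<in>(SIGMA I:Pow K. Pow I). G J (I - J) (K - I))"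
      by (rule sum.Sigma[OF fins(1,2)])
    also have "\<dots> = (\<Sum>(J, L)\<in>(SIGMA J:Pow K. Pow (K - J)). G J L (K - J - L))"
    proof -
      have diff: "K - J - (I - J) = K - I" if "J \<subseteq> I" for I J
        using that by auto
      show ?thesis
        by (rule sum.reindex_bij_witness[where i = "\<lambda>(J, L). (J \<union> L, J)" and j = "\<lambda>(I, J). (J, I - J)"])
          (auto simp: diff)
    qed
    also have "\<dots> = (\<Sum>J\<in>Pow K. \<Sum>L\<in>Pow (K - J). G J L (K - J - L))"
      by (rule sum.Sigma[OF fins(1,3), symmetric])
    also have "\<dots> = ext_wedge a (ext_wedge b c) K"
      unfolding ext_wedge_def sum_distrib_left sum_distrib_right
      by (intro sum.cong refl right[symmetric])
    finally show ?thesis .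
  qed
qed

lemma ext_wedge_omega_single:
  "ext_wedge (omega {k}) a K = (if finite K \<and> k \<in> K then ext_sign {k} (K - {k}) * a (K - {k}) else 0)"
proof (cases "finite K")
  case True
  have "ext_wedge (omega {k}) a K =
      (\<Sum>I\<in>Pow K. if I = {k} then ext_sign {k} (K - {k}) * a (K - {k}) else 0)"
    unfolding ext_wedge_def omega_def by (rule sum.cong) auto
  then show ?thesis using True by simp
qed (simp add: ext_wedge_def)

text \<open>
  Removing \<open>j\<close> and \<open>k\<close> from \<open>K\<close> in either order gives the same signs, except that exactly one of the
  two orders counts the inversion between \<open>j\<close> and \<open>k\<close>. For \<open>j = k\<close> both sides vanish.
\<close>

lemma ext_wedge_omega_anticommute:
  "ext_wedge (omega {j}) (ext_wedge (omega {k}) a) K = - ext_wedge (omega {k}) (ext_wedge (omega {j}) a) K"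
proof (cases "finite K \<and> j \<in> K \<and> k \<in> K \<and> j \<noteq> k")
  case True
  define L where "L = K - {j, k}"
  have L: "finite L" "j \<notin> L" "k \<notin> L" "K - {j} = insert k L" "K - {k} = insert j L"
    using True by (auto simp: L_def)
  show ?thesis
    using True L by (simp add: ext_wedge_omega_single ext_sign_insert insert_Diff_if)
qed (auto simp: ext_wedge_omega_single)

lemma ext_wedge_sum_left:
  "ext_wedge (\<lambda>K. \<Sum>i\<in>A. c i * a i K) b K = (\<Sum>i\<in>A. c i * ext_wedge (a i) b K)"
  unfolding ext_wedge_def sum_distrib_left sum_distrib_right
  by (subst sum.swap) (simp add: ac_simps)

lemma ext_wedge_omega_sum:
  "ext_wedge (omega {k}) (\<lambda>K. \<Sum>i\<in>A. a i K) K = (\<Sum>i\<in>A. ext_wedge (omega {k}) (a i) K)"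
  by (cases "finite K \<and> k \<in> K") (auto simp: ext_wedge_omega_single sum_distrib_left)

lemma ext_wedge_omega_zero: "ext_wedge (omega {k}) (\<lambda>_. 0) K = 0"
  by (simp add: ext_wedge_def)

lemma ext_wedge_omega_scale:
  "ext_wedge (omega {k}) (\<lambda>K. c * a K) K = c * ext_wedge (omega {k}) a K"
  by (simp add: ext_wedge_omega_single)

text \<open>
  The exterior algebra on \<open>\<omega>\<^sup>0, \<dots>, \<omega>\<^sup>M\<^sup>-\<^sup>1\<close>. Elements of type \<open>ext\<close> may involve further basis
  vectors, which \<open>dform\<close> ignores.
\<close>

definition ext_in :: "nat \<Rightarrow> ext \<Rightarrow> bool" where
  "ext_in M a \<longleftrightarrow> (\<forall>I. a I \<noteq> 0 \<longrightarrow> I \<subseteq> {..<M})"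

lemma ext_in_omega: "ext_in M (omega I) \<longleftrightarrow> I \<subseteq> {..<M}"
  by (auto simp: ext_in_def omega_def)

lemma ext_in_sum: "(\<And>i. i \<in> A \<Longrightarrow> ext_in M (a i)) \<Longrightarrow> ext_in M (\<lambda>K. \<Sum>i\<in>A. c i * a i K)"
  unfolding ext_in_def by (fastforce elim!: sum.not_neutral_contains_not_neutral)

lemma ext_in_ext_wedge:
  assumes "ext_in M a" "ext_in M b"
  shows "ext_in M (ext_wedge a b)"
  unfolding ext_in_def
proof (intro allI impI)
  fix K assume "ext_wedge a b K \<noteq> 0"
  then obtain I where "I \<in> Pow K" "a I \<noteq> 0" "b (K - I) \<noteq> 0"
    unfolding ext_wedge_def by (auto elim!: sum.not_neutral_contains_not_neutral)
  then show "K \<subseteq> {..<M}"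
    using assms unfolding ext_in_def by blast
qed

text \<open>
  The inner sums of \<open>dform\<close> and \<open>dist_dform\<close> have the shape of the left-hand side, which evaluates
  the product of \<open>\<omega>\<^sup>k\<close> with a form through its coordinates.
\<close>

lemma ext_wedge_omega_expand:
  assumes "ext_in M a"
  shows "(\<Sum>I\<in>Pow {..<M}. a I * ext_wedge (omega {k}) (omega I) K) = ext_wedge (omega {k}) a K"
proof (cases "finite K \<and> k \<in> K")
  case True
  have "(\<Sum>I\<in>Pow {..<M}. a I * ext_wedge (omega {k}) (omega I) K) =
      (\<Sum>I\<in>Pow {..<M}. if I = K - {k} then ext_sign {k} (K - {k}) * a (K - {k}) else 0)"
    using True by (intro sum.cong refl) (simp add: ext_wedge_omega_single, simp add: omega_def)
  also have "\<dots> = ext_wedge (omega {k}) a K"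
  proof (cases "a (K - {k}) = 0")
    case False
    then have "K - {k} \<in> Pow {..<M}"
      using assms by (auto simp: ext_in_def)
    then show ?thesis
      using True by (simp add: ext_wedge_omega_single sum.delta)
  qed (auto simp: ext_wedge_omega_single)
  finally show ?thesis .
qed (auto simp: ext_wedge_omega_single)

section \<open>Calculus with the operators \<open>nabla j \<alpha>\<close>\<close>

lemma xderiv_eqI: "(f has_derivative D) (at q) \<Longrightarrow> xderiv m f q = D (xdir m)"
  unfolding xderiv_def using frechet_derivative_at by metis

lemma has_derivative_cong_open:
  assumes "open S" "q \<in> S" "\<And>x. x \<in> S \<Longrightarrow> f x = g x"
  shows "(f has_derivative D) (at q) \<longleftrightarrow> (g has_derivative D) (at q)"
  using has_derivative_transform_within_open[OF _ assms(1,2)] assms(3) by metis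

lemma xderiv_cong_open:
  assumes "open S" "q \<in> S" "\<And>x. x \<in> S \<Longrightarrow> f x = g x"
  shows "xderiv m f q = xderiv m g q"
  unfolding xderiv_def frechet_derivative_def using has_derivative_cong_open[OF assms] by simp

lemma C_on_cong:
  assumes "open \<Omega>" "\<And>q. q \<in> \<Omega> \<Longrightarrow> f q = g q"
  shows "C_on k \<Omega> f \<longleftrightarrow> C_on k \<Omega> g"
  using assms(2)
proof (induction k arbitrary: f g)
  case 0
  then show ?case by (simp cong: continuous_on_cong)
next
  case (Suc k)
  have "f differentiable at q \<longleftrightarrow> g differentiable at q" if "q \<in> \<Omega>" for q
    unfolding differentiable_def using has_derivative_cong_open[OF assms(1) that] Suc.prems by metis
  moreover have "C_on k \<Omega> (xderiv m f) \<longleftrightarrow> C_on k \<Omega> (xderiv m g)" for m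
    using xderiv_cong_open[OF assms(1)] Suc.prems by (intro Suc.IH) blast
  ultimately show ?case by simp
qed

lemma C_on_SucD: "C_on (Suc k) \<Omega> f \<Longrightarrow> C_on k \<Omega> f"
proof (induction k arbitrary: f)
  case 0
  then show ?case
    by (auto intro!: continuous_at_imp_continuous_on differentiable_imp_continuous_within)
qed auto

lemma C_on_subset: "C_on k \<Omega> f \<Longrightarrow> S \<subseteq> \<Omega> \<Longrightarrow> C_on k S f"
  by (induction k arbitrary: f) (auto intro: continuous_on_subset)

lemma C_on_imp_differentiable: "C_on (Suc k) \<Omega> f \<Longrightarrow> q \<in> \<Omega> \<Longrightarrow> f differentiable at q"
  by simp

lemma C_on_imp_continuous_on: "C_on k \<Omega> f \<Longrightarrow> continuous_on \<Omega> f"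
  by (induction k) (use C_on_SucD in auto)

lemma xderiv_const [simp]: "xderiv m (\<lambda>_. c) = (\<lambda>_. 0)"
  by (rule ext, subst xderiv_eqI[OF has_derivative_const]) simp

lemma xderiv_add:
  assumes "f differentiable at q" "g differentiable at q"
  shows "xderiv m (\<lambda>x. f x + g x) q = xderiv m f q + xderiv m g q"
proof -
  have "((\<lambda>x. f x + g x) has_derivative
      (\<lambda>h. frechet_derivative f (at q) h + frechet_derivative g (at q) h)) (at q)"
    using assms by (intro has_derivative_add) (simp_all add: frechet_derivative_works[symmetric])
  from xderiv_eqI[OF this] show ?thesis
    by (simp add: xderiv_def)
qed

lemma xderiv_mult:
  assumes "f differentiable at q" "g differentiable at q"
  shows "xderiv m (\<lambda>x. f x * g x) q = xderiv m f q * g q + f q * xderiv m g q"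
proof -
  have "((\<lambda>x. f x * g x) has_derivative
      (\<lambda>h. f q * frechet_derivative g (at q) h + frechet_derivative f (at q) h * g q)) (at q)"
    using assms by (intro has_derivative_mult) (simp_all add: frechet_derivative_works[symmetric])
  from xderiv_eqI[OF this] show ?thesis
    by (simp add: xderiv_def)
qed

lemma xderiv_cmult:
  assumes "f differentiable at q"
  shows "xderiv m (\<lambda>x. c * f x) q = c * xderiv m f q"
  using xderiv_mult[of "\<lambda>_. c" q f m] assms by simp

lemma xderiv_sum:
  assumes "finite A" "\<And>i. i \<in> A \<Longrightarrow> f i differentiable at q"
  shows "xderiv m (\<lambda>x. \<Sum>i\<in>A. f i x) q = (\<Sum>i\<in>A. xderiv m (f i) q)"
  using assms
proof (induction A rule: finite_induct)
  case (insert i A)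
  then have "(\<lambda>x. \<Sum>i\<in>A. f i x) differentiable at q"
    by (intro differentiable_sum) auto
  then show ?case
    using insert by (simp add: xderiv_add)
qed simp

lemma C_on_const: "C_on k \<Omega> (\<lambda>_. c)"
  by (induction k arbitrary: c) simp_all

lemma C_on_add:
  assumes "open \<Omega>" "C_on k \<Omega> f" "C_on k \<Omega> g"
  shows "C_on k \<Omega> (\<lambda>q. f q + g q)"
  using assms(2,3)
proof (induction k arbitrary: f g)
  case (Suc k)
  have "C_on k \<Omega> (xderiv m (\<lambda>q. f q + g q))" if "m < 4 * CARD('a)" for m
  proof -
    have "C_on k \<Omega> (\<lambda>q. xderiv m f q + xderiv m g q)"
      using Suc that by simp
    then show ?thesis
      using Suc.prems by (subst C_on_cong[OF assms(1) xderiv_add]) simp_all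
  qed
  then show ?case
    using Suc.prems by (auto intro: differentiable_add)
qed (auto intro: continuous_intros)

lemma C_on_mult:
  assumes "open \<Omega>" "C_on k \<Omega> f" "C_on k \<Omega> g"
  shows "C_on k \<Omega> (\<lambda>q. f q * g q)"
  using assms(2,3)
proof (induction k arbitrary: f g)
  case (Suc k)
  have "C_on k \<Omega> (xderiv m (\<lambda>q. f q * g q))" if "m < 4 * CARD('a)" for m
  proof -
    have "C_on k \<Omega> (\<lambda>q. xderiv m f q * g q + f q * xderiv m g q)"
      using Suc.prems that C_on_SucD[OF Suc.prems(1)] C_on_SucD[OF Suc.prems(2)]
      by (intro C_on_add[OF assms(1)] Suc.IH) simp_all
    then show ?thesis
      using Suc.prems by (subst C_on_cong[OF assms(1) xderiv_mult]) simp_all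
  qed
  then show ?case
    using Suc.prems by (auto intro: differentiable_mult)
qed (auto intro: continuous_intros)

lemma nabla_comb_add: "nabla_comb j \<alpha> (\<lambda>m. D m + D' m) = nabla_comb j \<alpha> D + nabla_comb j \<alpha> D'"
  by (simp add: nabla_comb_def Let_def algebra_simps)

lemma nabla_comb_cmult: "nabla_comb j \<alpha> (\<lambda>m. c * D m) = c * nabla_comb j \<alpha> D"
  by (simp add: nabla_comb_def Let_def algebra_simps)

lemma nabla_comb_zero [simp]: "nabla_comb j \<alpha> (\<lambda>m. 0) = 0"
  using nabla_comb_cmult[of j \<alpha> 0] by simp

lemma nabla_comb_sum: "nabla_comb j \<alpha> (\<lambda>m. \<Sum>i\<in>A. D i m) = (\<Sum>i\<in>A. nabla_comb j \<alpha> (D i))"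
  by (induction A rule: infinite_finite_induct) (simp_all add: nabla_comb_add)

lemma nabla_comb_swap:
  "nabla_comb j \<alpha> (\<lambda>m. nabla_comb k \<beta> (\<lambda>l. D m l)) = nabla_comb k \<beta> (\<lambda>l. nabla_comb j \<alpha> (\<lambda>m. D m l))"
  by (simp add: nabla_comb_def Let_def algebra_simps)

text \<open>
  Regularity, integrability and limits pass from partial derivatives to the operators
  \<open>nabla j \<alpha>\<close> through this normal form, which hides the case distinction on \<open>j\<close> and \<open>\<alpha>\<close>.
\<close>

lemma nabla_comb_two_terms:
  assumes "j < 2 * N"
  shows "\<exists>m<4 * N. \<exists>m'<4 * N. \<exists>c d. \<forall>D. nabla_comb j \<alpha> D = c * D m + d * D m'"
proof -
  \<comment> \<open>The operator involves the real coordinates \<open>4l\<close>, \<open>4l +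
    1\<close> or \<open>4l + 2\<close>, \<open>4l + 3\<close> where \<open>l = j div
    2\<close>.\<close>
  define r where "r = (if even j = (\<alpha> = 0) then 0 else 2 :: nat)"
  define m where "m = 4 * (j div 2) + r"
  have "m < 4 * N" "m + 1 < 4 * N"
    using assms unfolding m_def r_def by presburger+
  moreover have "nabla_comb j \<alpha> D = (if even j \<and> \<alpha> \<noteq> 0 then -1 else 1) * D m +
      (if even j \<and> \<alpha> = 0 then \<i> else -\<i>) * D (m + 1)" for D
    by (simp add: nabla_comb_def Let_def m_def r_def numeral_3_eq_3)
  ultimately show ?thesis
    by blast
qed

lemma nabla_comb_cong:
  assumes "j < 2 * N" "\<And>m. m < 4 * N \<Longrightarrow> D m = D' m"
  shows "nabla_comb j \<alpha> D = nabla_comb j \<alpha> D'"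
proof -
  obtain c d m m' where "m < 4 * N" "m' < 4 * N" "\<forall>D. nabla_comb j \<alpha> D = c * D m + d * D m'"
    using nabla_comb_two_terms[OF assms(1), of \<alpha>] by blast
  then show ?thesis
    using assms(2) by simp
qed

lemma C_on_nabla:
  fixes f :: "'n::{finite,linorder} hspace \<Rightarrow> complex"
  assumes "open \<Omega>" "C_on (Suc k) \<Omega> f" "j < 2 * CARD('n)"
  shows "C_on k \<Omega> (nabla j \<alpha> f)"
proof -
  obtain c d m m' where m: "m < 4 * CARD('n)" "m' < 4 * CARD('n)"
      and eq: "\<forall>D. nabla_comb j \<alpha> D = c * D m + d * D m'"
    using nabla_comb_two_terms[OF assms(3), of \<alpha>] by blast
  show ?thesis
    unfolding nabla_def[abs_def] eq[rule_format] using assms m by (intro C_on_add C_on_mult C_on_const) auto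
qed

lemma nabla_mult:
  assumes "f differentiable at q" "g differentiable at q"
  shows "nabla j \<alpha> (\<lambda>x. f x * g x) q = nabla j \<alpha> f q * g q + f q * nabla j \<alpha> g q"
  using assms by (simp add: nabla_def xderiv_mult nabla_comb_add nabla_comb_cmult mult.commute[of _ "g q"])

lemma nabla_const [simp]: "nabla j \<alpha> (\<lambda>_. c) = (\<lambda>_. 0)"
  by (simp add: nabla_def fun_eq_iff)

lemma nabla_sum_cmult:
  assumes "finite A" "\<And>i. i \<in> A \<Longrightarrow> f i differentiable at q"
  shows "nabla j \<alpha> (\<lambda>x. \<Sum>i\<in>A. f i x * c i) q = (\<Sum>i\<in>A. nabla j \<alpha> (f i) q * c i)"
  using assms
  by (simp add: nabla_def xderiv_sum xderiv_mult differentiable_mult nabla_comb_sum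
      nabla_comb_cmult mult.commute[of _ "c _"])

lemma has_vector_derivative_minus_scaleR:
  assumes "(g has_vector_derivative g') (at s within S)"
  shows "((\<lambda>s. g s - s *\<^sub>R L) has_derivative (\<lambda>h. h *\<^sub>R (g' - L))) (at s within S)"
  using assms unfolding has_vector_derivative_def
  by (auto intro!: derivative_eq_intros simp: scaleR_diff_right)

text \<open>
  The mean value inequality, applied first in the direction \<open>b\<close> to \<open>f1\<close> and then in the direction
  \<open>a\<close> to the increments of \<open>f\<close>, compares the symmetric second difference of \<open>f\<close> with the mixed
  derivative \<open>f2\<close>.
\<close>

lemma second_difference_estimate:
  fixes f :: "'a::real_normed_vector \<Rightarrow> complex"
  assumes t: "0 < t"
    and Df: "\<And>s \<tau>. s \<in> {0..t} \<Longrightarrow> \<tau> \<in> {0..t} \<Longrightarrow>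
      ((\<lambda>s. f (q + s *\<^sub>R a + \<tau> *\<^sub>R b)) has_vector_derivative f1 (q + s *\<^sub>R a + \<tau> *\<^sub>R b)) (at s)"
    and Df1: "\<And>s \<tau>. s \<in> {0..t} \<Longrightarrow> \<tau> \<in> {0..t} \<Longrightarrow>
      ((\<lambda>\<tau>. f1 (q + s *\<^sub>R a + \<tau> *\<^sub>R b)) has_vector_derivative f2 (q + s *\<^sub>R a + \<tau> *\<^sub>R b)) (at \<tau>)"
    and near: "\<And>s \<tau>. s \<in> {0..t} \<Longrightarrow> \<tau> \<in> {0..t} \<Longrightarrow> norm (f2 (q + s *\<^sub>R a + \<tau> *\<^sub>R b) - L) \<le> e"
  shows "norm (f (q + t *\<^sub>R a + t *\<^sub>R b) - f (q + t *\<^sub>R a) - f (q + t *\<^sub>R b) + f q - t\<^sup>2 *\<^sub>R L) \<le> e * t\<^sup>2"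
proof -
  have 1: "norm (f1 (q + s *\<^sub>R a + t *\<^sub>R b) - f1 (q + s *\<^sub>R a) - t *\<^sub>R L) \<le> e * t" if s: "s \<in> {0..t}" for s
  proof -
    have "norm ((f1 (q + s *\<^sub>R a + t *\<^sub>R b) - t *\<^sub>R L) - (f1 (q + s *\<^sub>R a + 0 *\<^sub>R b) - 0 *\<^sub>R L)) \<le> e * norm (t - 0)"
    proof (rule differentiable_bound[of "{0..t}" "\<lambda>\<tau>. f1 (q + s *\<^sub>R a + \<tau> *\<^sub>R b) - \<tau> *\<^sub>R L"
          "\<lambda>\<tau> h. h *\<^sub>R (f2 (q + s *\<^sub>R a + \<tau> *\<^sub>R b) - L)"])
      fix \<tau> assume \<tau>: "\<tau> \<in> {0..t}"
      show "((\<lambda>\<tau>. f1 (q + s *\<^sub>R a + \<tau> *\<^sub>R b) - \<tau> *\<^sub>R L) has_derivative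
          (\<lambda>h. h *\<^sub>R (f2 (q + s *\<^sub>R a + \<tau> *\<^sub>R b) - L))) (at \<tau> within {0..t})"
        by (intro has_vector_derivative_minus_scaleR has_vector_derivative_at_within[OF Df1[OF s \<tau>]])
      show "onorm (\<lambda>h. h *\<^sub>R (f2 (q + s *\<^sub>R a + \<tau> *\<^sub>R b) - L)) \<le> e"
        using near[OF s \<tau>] by (intro onorm_le) (simp add: mult_left_mono mult.commute[of e])
    qed (use t in auto)
    then show ?thesis using t by (simp add: algebra_simps)
  qed
  have "norm ((f (q + t *\<^sub>R a + t *\<^sub>R b) - f (q + t *\<^sub>R a + 0 *\<^sub>R b) - t *\<^sub>R (t *\<^sub>R L)) -
     (f (q + 0 *\<^sub>R a + t *\<^sub>R b) - f (q + 0 *\<^sub>R a + 0 *\<^sub>R b) - 0 *\<^sub>R (t *\<^sub>R L))) \<le> (e * t) * norm (t - 0)"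
  proof (rule differentiable_bound[of "{0..t}"
        "\<lambda>s. f (q + s *\<^sub>R a + t *\<^sub>R b) - f (q + s *\<^sub>R a + 0 *\<^sub>R b) - s *\<^sub>R (t *\<^sub>R L)"
        "\<lambda>s h. h *\<^sub>R (f1 (q + s *\<^sub>R a + t *\<^sub>R b) - f1 (q + s *\<^sub>R a + 0 *\<^sub>R b) - t *\<^sub>R L)"])
    fix s assume s: "s \<in> {0..t}"
    have t0: "t \<in> {0..t}" "0 \<in> {0..t}" using t by auto
    show "((\<lambda>s. f (q + s *\<^sub>R a + t *\<^sub>R b) - f (q + s *\<^sub>R a + 0 *\<^sub>R b) - s *\<^sub>R (t *\<^sub>R L)) has_derivative
        (\<lambda>h. h *\<^sub>R (f1 (q + s *\<^sub>R a + t *\<^sub>R b) - f1 (q + s *\<^sub>R a + 0 *\<^sub>R b) - t *\<^sub>R L))) (at s within {0..t})"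
      by (intro has_vector_derivative_minus_scaleR has_vector_derivative_diff
          has_vector_derivative_at_within[OF Df[OF s t0(1)]] has_vector_derivative_at_within[OF Df[OF s t0(2)]])
    show "onorm (\<lambda>h. h *\<^sub>R (f1 (q + s *\<^sub>R a + t *\<^sub>R b) - f1 (q + s *\<^sub>R a + 0 *\<^sub>R b) - t *\<^sub>R L)) \<le> e * t"
      using 1[OF s] by (intro onorm_le) (simp add: mult_left_mono mult.commute[of "e * t"])
  qed (use t in auto)
  then show ?thesis
    using t by (simp add: power2_eq_square algebra_simps)
qed

lemma xderiv_has_vector_derivative:
  assumes "f differentiable at (q + s *\<^sub>R xdir m + v)"
  shows "((\<lambda>s. f (q + s *\<^sub>R xdir m + v)) has_vector_derivative xderiv m f (q + s *\<^sub>R xdir m + v)) (at s)"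
proof -
  have "((\<lambda>s. q + s *\<^sub>R xdir m + v) has_derivative (\<lambda>h. h *\<^sub>R xdir m)) (at s)"
    by (auto intro!: derivative_eq_intros)
  from has_derivative_compose[OF this] assms
  have "((\<lambda>s. f (q + s *\<^sub>R xdir m + v)) has_derivative
      (\<lambda>h. frechet_derivative f (at (q + s *\<^sub>R xdir m + v)) (h *\<^sub>R xdir m))) (at s)"
    unfolding frechet_derivative_works by blast
  moreover have "linear (frechet_derivative f (at (q + s *\<^sub>R xdir m + v)))"
    using assms by (rule linear_frechet_derivative)
  ultimately show ?thesis
    by (simp add: has_vector_derivative_def xderiv_def linear_cmul)
qed

text \<open>
  The second difference is symmetric in the two directions, and divided by \<open>t\<^sup>2\<close> it is close to
  either of the two mixed derivatives at \<open>q\<close>.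
\<close>

lemma xderiv_commute:
  fixes f :: "'n::{finite,linorder} hspace \<Rightarrow> complex"
  assumes "open \<Omega>" "q \<in> \<Omega>" "C_on 2 \<Omega> f" "l < 4 * CARD('n)" "m < 4 * CARD('n)"
  shows "xderiv l (xderiv m f) q = xderiv m (xderiv l f) q"
proof (rule ccontr)
  assume neq: "xderiv l (xderiv m f) q \<noteq> xderiv m (xderiv l f) q"
  \<comment> \<open>A third of the gap: the two estimates for the second difference together account
    for two thirds.\<close>
  define e where "e = norm (xderiv l (xderiv m f) q - xderiv m (xderiv l f) q) / 3"
  have "e > 0" using neq by (simp add: e_def)
  have C2: "f differentiable at x" "\<forall>k<4 * CARD('n). xderiv k f differentiable at x"
    "\<forall>i<4 * CARD('n). \<forall>k<4 * CARD('n). continuous_on \<Omega> (xderiv i (xderiv k f))" if "x \<in> \<Omega>" for x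
    using assms(3) that by (auto simp: numeral_2_eq_2)
  have close: "\<exists>d>0. \<forall>x. dist x q < d \<longrightarrow> x \<in> \<Omega> \<and> norm (xderiv i (xderiv k f) x - xderiv i (xderiv k f) q) \<le> e"
    if "i < 4 * CARD('n)" "k < 4 * CARD('n)" for i k
  proof -
    obtain d1 where d1: "d1 > 0" "\<And>x. dist x q < d1 \<Longrightarrow> x \<in> \<Omega>"
      using assms(1,2) unfolding open_dist by blast
    have "continuous_on \<Omega> (xderiv i (xderiv k f))"
      using C2(3)[OF assms(2)] that by blast
    then obtain d2 where "d2 > 0"
      "\<And>x. x \<in> \<Omega> \<Longrightarrow> dist x q < d2 \<Longrightarrow> dist (xderiv i (xderiv k f) x) (xderiv i (xderiv k f) q) < e"
      using assms(2) \<open>e > 0\<close> unfolding continuous_on_iff by metis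
    then show ?thesis
      using d1 by (intro exI[of _ "min d1 d2"]) (auto simp: dist_norm less_imp_le)
  qed
  obtain d1 where d1: "d1 > 0" "\<And>x. dist x q < d1 \<Longrightarrow> x \<in> \<Omega>"
      "\<And>x. dist x q < d1 \<Longrightarrow> norm (xderiv l (xderiv m f) x - xderiv l (xderiv m f) q) \<le> e"
    using close[OF assms(4,5)] by blast
  obtain d2 where d2: "d2 > 0"
      "\<And>x. dist x q < d2 \<Longrightarrow> norm (xderiv m (xderiv l f) x - xderiv m (xderiv l f) q) \<le> e"
    using close[OF assms(5,4)] by blast
  define A where "A = norm (xdir l :: 'n hspace) + norm (xdir m :: 'n hspace)"
  \<comment> \<open>Small enough for the parallelogram with sides \<open>t *\<^sub>R xdir l\<close>
    and \<open>t *\<^sub>R xdir m\<close> to stay where both mixed derivatives vary by at most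
    \<open>e\<close>.\<close>
  define t where "t = min d1 d2 / (2 * (A + 1))"
  have A: "A \<ge> 0" by (simp add: A_def)
  have t: "t > 0" using d1(1) d2(1) A by (simp add: t_def)
  have "t * A < min d1 d2"
  proof -
    have "t * A \<le> t * (A + 1)" using t by simp
    also have "\<dots> = min d1 d2 / 2" using A by (simp add: t_def field_simps)
    finally show ?thesis using d1 d2 by linarith
  qed
  have near: "dist (q + s *\<^sub>R xdir i + \<tau> *\<^sub>R xdir k) q < min d1 d2"
    if "s \<in> {0..t}" "\<tau> \<in> {0..t}" "{i, k} = {l, m}" for s \<tau> i k
  proof -
    have "dist (q + s *\<^sub>R xdir i + \<tau> *\<^sub>R xdir k) q = norm (s *\<^sub>R (xdir i :: 'n hspace) + \<tau> *\<^sub>R xdir k)"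
      by (simp add: dist_norm)
    also have "\<dots> \<le> s * norm (xdir i :: 'n hspace) + \<tau> * norm (xdir k :: 'n hspace)"
      using that norm_triangle_ineq[of "s *\<^sub>R (xdir i :: 'n hspace)" "\<tau> *\<^sub>R xdir k"] by simp
    also have "\<dots> \<le> t * norm (xdir i :: 'n hspace) + t * norm (xdir k :: 'n hspace)"
      using that by (intro add_mono mult_right_mono) auto
    also have "\<dots> = t * A"
      using that(3) unfolding A_def doubleton_eq_iff by (auto simp: algebra_simps)
    finally show ?thesis using \<open>t * A < min d1 d2\<close> by linarith
  qed
  define Q where "Q = f (q + t *\<^sub>R xdir l + t *\<^sub>R xdir m) - f (q + t *\<^sub>R xdir l) - f (q + t *\<^sub>R xdir m) + f q"
  have main: "norm (f (q + t *\<^sub>R xdir i + t *\<^sub>R xdir k) - f (q + t *\<^sub>R xdir i) - f (q + t *\<^sub>R xdir k) + f q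
        - t\<^sup>2 *\<^sub>R xderiv k (xderiv i f) q) \<le> e * t\<^sup>2" if ik: "{i, k} = {l, m}" for i k
  proof (rule second_difference_estimate[OF t, where ?f1.0 = "xderiv i f" and ?f2.0 = "xderiv k (xderiv i f)"])
    fix s \<tau> assume s: "s \<in> {0..t}" "\<tau> \<in> {0..t}"
    have i: "i < 4 * CARD('n)" "k < 4 * CARD('n)"
      using ik assms(4,5) by (auto simp: doubleton_eq_iff)
    have x: "q + s *\<^sub>R xdir i + \<tau> *\<^sub>R xdir k \<in> \<Omega>"
      using near[OF s ik] d1(2) by simp
    show "((\<lambda>s. f (q + s *\<^sub>R xdir i + \<tau> *\<^sub>R xdir k)) has_vector_derivative
        xderiv i f (q + s *\<^sub>R xdir i + \<tau> *\<^sub>R xdir k)) (at s)"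
      by (rule xderiv_has_vector_derivative[OF C2(1)[OF x]])
    show "((\<lambda>\<tau>. xderiv i f (q + s *\<^sub>R xdir i + \<tau> *\<^sub>R xdir k)) has_vector_derivative
        xderiv k (xderiv i f) (q + s *\<^sub>R xdir i + \<tau> *\<^sub>R xdir k)) (at \<tau>)"
      using xderiv_has_vector_derivative[of "xderiv i f" "q + s *\<^sub>R xdir i" \<tau> k 0] C2(2)[OF x] i by simp
    show "norm (xderiv k (xderiv i f) (q + s *\<^sub>R xdir i + \<tau> *\<^sub>R xdir k) - xderiv k (xderiv i f) q) \<le> e"
      using near[OF s ik] d1(3) d2(2) ik by (auto simp: doubleton_eq_iff)
  qed
  have "norm (Q - t\<^sup>2 *\<^sub>R xderiv m (xderiv l f) q) \<le> e * t\<^sup>2"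
    unfolding Q_def using main[of l m] by simp
  moreover have "norm (Q - t\<^sup>2 *\<^sub>R xderiv l (xderiv m f) q) \<le> e * t\<^sup>2"
    unfolding Q_def using main[of m l] by (simp add: insert_commute algebra_simps)
  ultimately have "norm (t\<^sup>2 *\<^sub>R xderiv l (xderiv m f) q - t\<^sup>2 *\<^sub>R xderiv m (xderiv l f) q) \<le> 2 * e * t\<^sup>2"
    using norm_triangle_ineq4[of "Q - t\<^sup>2 *\<^sub>R xderiv m (xderiv l f) q" "Q - t\<^sup>2 *\<^sub>R xderiv l (xderiv m f) q"]
    by simp
  moreover have "norm (t\<^sup>2 *\<^sub>R xderiv l (xderiv m f) q - t\<^sup>2 *\<^sub>R xderiv m (xderiv l f) q) = 3 * (e * t\<^sup>2)"
    by (subst scaleR_diff_right[symmetric]) (simp add: e_def)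
  moreover have "e * t\<^sup>2 > 0"
    using t \<open>e > 0\<close> by simp
  ultimately show False
    by linarith
qed

lemma nabla_commute:
  fixes f :: "'n::{finite,linorder} hspace \<Rightarrow> complex"
  assumes "open \<Omega>" "q \<in> \<Omega>" "C_on 2 \<Omega> f" "j < 2 * CARD('n)" "k < 2 * CARD('n)"
  shows "nabla j \<alpha> (nabla k \<beta> f) q = nabla k \<beta> (nabla j \<alpha> f) q"
proof -
  have nabla_nabla: "nabla i \<alpha> (nabla l \<beta> f) q = nabla_comb i \<alpha> (\<lambda>m. nabla_comb l \<beta> (\<lambda>m'. xderiv m (xderiv m' f) q))"
    if l: "l < 2 * CARD('n)" for i l \<alpha> \<beta>
  proof -
    have D: "xderiv m f differentiable at q" if "m < 4 * CARD('n)" for m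
      using assms(2,3) that by (simp add: numeral_2_eq_2)
    obtain c d i' l' where m: "i' < 4 * CARD('n)" "l' < 4 * CARD('n)"
        and eq: "\<forall>D. nabla_comb l \<beta> D = c * D i' + d * D l'"
      using nabla_comb_two_terms[OF l, of \<beta>] by blast
    have "xderiv m (nabla l \<beta> f) q = nabla_comb l \<beta> (\<lambda>m'. xderiv m (xderiv m' f) q)" for m
      unfolding nabla_def[abs_def] eq[rule_format] using D m
      by (simp add: xderiv_add xderiv_cmult differentiable_mult)
    then show ?thesis by (simp add: nabla_def)
  qed
  show ?thesis
    unfolding nabla_nabla[OF assms(4)] nabla_nabla[OF assms(5)]
    by (subst nabla_comb_swap, intro nabla_comb_cong[OF assms(5)] nabla_comb_cong[OF assms(4)]
      xderiv_commute[OF assms(1-3)])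
qed

section \<open>Functions with compact support\<close>

text \<open>
  The condition is phrased with some compact set rather than with the closure of the support, so
  that it passes directly to products and derivatives.
\<close>

definition C_c :: "nat \<Rightarrow> 'n::{finite,linorder} hspace set \<Rightarrow> ('n hspace \<Rightarrow> complex) set" where
  "C_c k \<Omega> = {\<phi>. C_on k UNIV \<phi> \<and> (\<exists>S. compact S \<and> S \<subseteq> \<Omega> \<and> (\<forall>q. q \<notin> S \<longrightarrow> \<phi> q = 0))}"

lemma eq_0_outside_closure_support: "q \<notin> closure {q. \<phi> q \<noteq> 0} \<Longrightarrow> \<phi> q = 0"
  using closure_subset[of "{q. \<phi> q \<noteq> 0}"] by blast

lemma test_functions_subset_C_c: "test_functions \<Omega> \<subseteq> C_c k \<Omega>"
  unfolding test_functions_def C_c_def using eq_0_outside_closure_support by blast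

lemma xderiv_eq_0_outside:
  assumes "closed S" "\<And>x. x \<notin> S \<Longrightarrow> \<phi> x = 0" "q \<notin> S"
  shows "xderiv m \<phi> q = 0"
  using xderiv_cong_open[of "- S" q \<phi> "\<lambda>_. 0" m] assms by auto

lemma C_c_antimono: "\<phi> \<in> C_c (Suc k) \<Omega> \<Longrightarrow> \<phi> \<in> C_c k \<Omega>"
  unfolding C_c_def using C_on_SucD by blast

lemma C_c_imp_differentiable: "\<phi> \<in> C_c (Suc k) \<Omega> \<Longrightarrow> \<phi> differentiable at q"
  by (simp add: C_c_def)

lemma C_c_xderiv:
  fixes \<phi> :: "'n::{finite,linorder} hspace \<Rightarrow> complex"
  assumes "\<phi> \<in> C_c (Suc k) \<Omega>" "m < 4 * CARD('n)"
  shows "xderiv m \<phi> \<in> C_c k \<Omega>"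
proof -
  obtain S where "compact S" "S \<subseteq> \<Omega>" "\<And>q. q \<notin> S \<Longrightarrow> \<phi> q = 0"
    using assms(1) by (auto simp: C_c_def)
  then have "compact S" "S \<subseteq> \<Omega>" "\<And>q. q \<notin> S \<Longrightarrow> xderiv m \<phi> q = 0"
    using xderiv_eq_0_outside compact_imp_closed by blast+
  then show ?thesis
    using assms by (auto simp: C_c_def)
qed

lemma C_c_nabla:
  fixes \<phi> :: "'n::{finite,linorder} hspace \<Rightarrow> complex"
  assumes "\<phi> \<in> C_c (Suc k) \<Omega>" "j < 2 * CARD('n)"
  shows "nabla j \<alpha> \<phi> \<in> C_c k \<Omega>"
proof -
  obtain S where S: "compact S" "S \<subseteq> \<Omega>" "\<And>q. q \<notin> S \<Longrightarrow> \<phi> q = 0"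
    using assms(1) by (auto simp: C_c_def)
  then have "nabla j \<alpha> \<phi> q = 0" if "q \<notin> S" for q
    unfolding nabla_def using xderiv_eq_0_outside[OF compact_imp_closed[OF S(1)] S(3) that] by simp
  moreover have "C_on k UNIV (nabla j \<alpha> \<phi>)"
    using assms by (intro C_on_nabla) (auto simp: C_c_def simp del: C_on.simps)
  ultimately show ?thesis
    using S by (auto simp: C_c_def)
qed

text \<open>
  Used to glue a function on \<open>\<Omega>\<close> with zero on the complement of a compact subset.
\<close>

lemma C_on_Un:
  assumes "open A" "open B" "C_on k A f" "C_on k B f"
  shows "C_on k (A \<union> B) f"
  using assms(3,4)
proof (induction k arbitrary: f)
  case 0
  then show ?case
    using assms(1,2) by (simp add: continuous_on_open_Un)
qed auto

lemma C_c_mult: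
  assumes "open \<Omega>" "C_on k \<Omega> f" "\<phi> \<in> C_c k \<Omega>"
  shows "(\<lambda>q. f q * \<phi> q) \<in> C_c k \<Omega>"
proof -
  obtain S where S: "compact S" "S \<subseteq> \<Omega>" "\<And>q. q \<notin> S \<Longrightarrow> \<phi> q = 0"
    using assms(3) by (auto simp: C_c_def)
  have "C_on k \<Omega> (\<lambda>q. f q * \<phi> q)"
    using assms C_on_subset[of k UNIV \<phi> \<Omega>] by (intro C_on_mult) (auto simp: C_c_def)
  moreover have "C_on k (- S) (\<lambda>q. f q * \<phi> q)"
    using C_on_cong[of "- S" "\<lambda>q. f q * \<phi> q" "\<lambda>_. 0" k] S compact_imp_closed[OF S(1)]
    by (auto simp: C_on_const)
  ultimately have "C_on k (\<Omega> \<union> - S) (\<lambda>q. f q * \<phi> q)"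
    using assms(1) S(1) by (intro C_on_Un) (auto simp: compact_imp_closed open_Compl)
  moreover have "\<Omega> \<union> - S = UNIV"
    using S(2) by auto
  ultimately show ?thesis
    using S by (auto simp: C_c_def)
qed

lemma C_c_integrable:
  assumes "open \<Omega>" "continuous_on \<Omega> F" "\<phi> \<in> C_c k \<Omega>"
  shows "set_integrable lborel \<Omega> (\<lambda>q. F q * \<phi> q)"
proof -
  obtain S where S: "compact S" "S \<subseteq> \<Omega>" "\<And>q. q \<notin> S \<Longrightarrow> \<phi> q = 0"
    using assms(3) by (auto simp: C_c_def)
  have "continuous_on S (\<lambda>q. F q * \<phi> q)"
    using assms S C_on_imp_continuous_on[of k UNIV \<phi>]
    by (intro continuous_intros) (auto simp: C_c_def intro: continuous_on_subset)
  then have "integrable lborel (\<lambda>q. indicator S q *\<^sub>R (F q * \<phi> q))"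
    by (rule borel_integrable_compact[OF S(1)])
  also have "(\<lambda>q. indicator S q *\<^sub>R (F q * \<phi> q)) = (\<lambda>q. indicator \<Omega> q *\<^sub>R (F q * \<phi> q))"
    using S by (auto simp: indicator_def fun_eq_iff)
  finally show ?thesis
    by (simp add: set_integrable_def)
qed

section \<open>Convolution\<close>

text \<open>
  The coordinate directions exhaust the standard basis; hence the derivative of a function is
  determined by its partial derivatives \<open>xderiv m\<close> with \<open>m < 4n\<close>.
\<close>

lemma Basis_subset_xdir: "(Basis :: 'n::{finite,linorder} hspace set) \<subseteq> xdir ` {..<4 * CARD('n)}"
proof
  fix b :: "'n hspace" assume "b \<in> Basis"
  then obtain i c where b: "b = axis i (axis c 1)"
    by (auto simp: Basis_vec_def)
  have "i \<in> set (sorted_list_of_set UNIV)"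
    by simp
  then obtain p where p: "p < CARD('n)" "sorted_list_of_set UNIV ! p = i"
    by (auto simp: in_set_conv_nth simp del: set_sorted_list_of_set)
  have "\<exists>r<4. of_nat (Suc r) = c"
  proof -
    have "of_nat (Suc 0) = (1::4)" "of_nat (Suc 1) = (2::4)" "of_nat (Suc 2) = (3::4)" "of_nat (Suc 3) = (4::4)"
      by simp_all
    moreover have "0 < (4::nat)" "1 < (4::nat)" "2 < (4::nat)" "3 < (4::nat)"
      by simp_all
    ultimately show ?thesis
      using exhaust_4[of c] by metis
  qed
  then obtain r where r: "r < 4" "of_nat (Suc r) = c" by blast
  have "xdir (4 * p + r) = b"
    using p r by (simp add: xdir_def b)
  moreover have "4 * p + r < 4 * CARD('n)"
    using p r by simp
  ultimately show "b \<in> xdir ` {..<4 * CARD('n)}"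
    by blast
qed

text \<open>
  Differentiation under the integral sign needs the derivative as a continuous map into the
  bounded linear functions, whereas \<open>C_on 1\<close> speaks of partial derivatives only.
\<close>

lemma C1_has_continuous_derivative:
  fixes g :: "'n::{finite,linorder} hspace \<Rightarrow> complex"
  assumes "C_on 1 UNIV g"
  obtains G :: "'n hspace \<Rightarrow> 'n hspace \<Rightarrow>\<^sub>L complex"
  where "continuous_on UNIV G" "\<And>x. (g has_derivative blinfun_apply (G x)) (at x)"
proof
  define D where "D b x = frechet_derivative g (at x) b" for b x
  define G where "G x = (\<Sum>b\<in>Basis. blinfun_scaleR_left (D b x) o\<^sub>L blinfun_inner_right b)" for x :: "'n hspace"
  have "continuous_on UNIV (D b)" if b: "b \<in> Basis" for b
  proof -
    obtain m where "m < 4 * CARD('n)" "b = xdir m"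
      using Basis_subset_xdir b by blast
    then have "D b = xderiv m g"
      by (simp add: D_def xderiv_def fun_eq_iff)
    then show ?thesis
      using assms \<open>m < 4 * CARD('n)\<close> by simp
  qed
  then show "continuous_on UNIV G"
    unfolding G_def
    by (intro continuous_intros bounded_linear.continuous_on[OF bounded_linear_blinfun_scaleR_left]) auto
  fix x
  have d: "(g has_derivative frechet_derivative g (at x)) (at x)"
    using assms by (simp add: frechet_derivative_works[symmetric])
  then have lin: "linear (frechet_derivative g (at x))"
    by (rule has_derivative_linear)
  have "blinfun_apply (G x) v = frechet_derivative g (at x) v" for v
  proof -
    have "frechet_derivative g (at x) v = frechet_derivative g (at x) (\<Sum>b\<in>Basis. (v \<bullet> b) *\<^sub>R b)"
      by (simp add: euclidean_representation)
    also have "\<dots> = (\<Sum>b\<in>Basis. (v \<bullet> b) *\<^sub>R D b x)"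
      by (simp add: linear_sum[OF lin] linear_cmul[OF lin] D_def)
    also have "\<dots> = blinfun_apply (G x) v"
      by (simp add: G_def blinfun.sum_left inner_commute)
    finally show ?thesis by simp
  qed
  then show "(g has_derivative blinfun_apply (G x)) (at x)"
    using d by (metis (no_types, lifting) ext)
qed

definition conv :: "('n::{finite,linorder} hspace \<Rightarrow> complex) \<Rightarrow> ('n hspace \<Rightarrow> complex) \<Rightarrow> 'n hspace \<Rightarrow> complex" where
  "conv f g x = (LINT y|lborel. f y * g (x - y))"

lemma lborel_integral_reflect:
  fixes h :: "'a::euclidean_space \<Rightarrow> complex"
  assumes "h \<in> borel_measurable borel"
  shows "(LINT y|lborel. h (x - y)) = (LINT y|lborel. h y)"
proof -
  have "(lborel :: 'a measure) = distr lborel borel (\<lambda>y. x - y)"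
    using lborel_affine[of "-1" x] by (simp add: density_1)
  then have "(LINT y|lborel. h y) = (LINT y|distr lborel borel (\<lambda>y. x - y). h y)"
    by simp
  also have "\<dots> = (LINT y|lborel. h (x - y))"
    using assms by (intro integral_distr) measurable
  finally show ?thesis by simp
qed

lemma conv_commute:
  assumes "continuous_on UNIV f" "continuous_on UNIV g"
  shows "conv f g x = conv g f x"
proof -
  have "(\<lambda>y. f y * g (x - y)) \<in> borel_measurable borel"
    by (intro borel_measurable_continuous_onI continuous_intros assms
        continuous_on_compose2[OF assms(2)]) auto
  from lborel_integral_reflect[OF this, of x] show ?thesis
    by (simp add: conv_def mult.commute)
qed

lemma lborel_integral_eq_integral_cbox:
  fixes h :: "'a::euclidean_space \<Rightarrow> complex"
  assumes "continuous_on UNIV h" "\<And>y. y \<notin> cbox a b \<Longrightarrow> h y = 0"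
  shows "(LINT y|lborel. h y) = integral (cbox a b) h"
proof -
  have "integrable lborel (\<lambda>y. indicator (cbox a b) y *\<^sub>R h y)"
    using assms(1) by (intro borel_integrable_compact compact_cbox) (auto intro: continuous_on_subset)
  moreover have "(\<lambda>y. indicator (cbox a b) y *\<^sub>R h y) = h"
    using assms(2) by (auto simp: indicator_def fun_eq_iff)
  ultimately have "(LINT y|lborel. h y) = integral UNIV h"
    by (simp add: integral_lborel)
  also have "integral UNIV h = integral UNIV (\<lambda>y. if y \<in> cbox a b then h y else 0)"
    using assms(2) by (intro arg_cong[where f = "integral UNIV"]) auto
  also have "\<dots> = integral (cbox a b) h"
    by (rule integral_restrict_UNIV)
  finally show ?thesis .
qed

text \<open>
  For \<open>x\<close> near \<open>x0\<close> the integrand of the convolution vanishes outside a box that is the same for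
  all such \<open>x\<close> and for all \<open>g\<close> supported in \<open>S\<close>, in particular for a function and its derivatives.
\<close>

lemma conv_eq_integral_cbox:
  fixes S :: "'n::{finite,linorder} hspace set"
  assumes "compact S" and f: "continuous_on UNIV f"
  shows "\<exists>a b. \<forall>g. continuous_on UNIV g \<longrightarrow> (\<forall>z. z \<notin> S \<longrightarrow> g z = 0) \<longrightarrow>
    (\<forall>x\<in>ball x0 1. conv f g x = integral (cbox a b) (\<lambda>y. f y * g (x - y)))"
proof -
  obtain R where R: "\<And>x. x \<in> S \<Longrightarrow> norm x \<le> R"
    using compact_imp_bounded[OF assms(1)] unfolding bounded_iff by blast
  obtain a b where ab: "cball x0 (R + 1) \<subseteq> cbox a b"
    using bounded_subset_cbox_symmetric[OF bounded_cball] by metis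
  have "conv f g x = integral (cbox a b) (\<lambda>y. f y * g (x - y))"
    if x: "x \<in> ball x0 1" and g: "continuous_on UNIV g" "\<And>z. z \<notin> S \<Longrightarrow> g z = 0" for x g
    unfolding conv_def
  proof (rule lborel_integral_eq_integral_cbox)
    show "continuous_on UNIV (\<lambda>y. f y * g (x - y))"
      by (intro continuous_intros f continuous_on_compose2[OF g(1)]) auto
    fix y assume "y \<notin> cbox a b"
    then have "y \<notin> cball x0 (R + 1)"
      using ab by blast
    then have "norm (x - y) > R"
      using x norm_triangle_ineq[of "x0 - x" "x - y"] by (simp add: dist_norm)
    then have "x - y \<notin> S"
      using R by fastforce
    then show "f y * g (x - y) = 0"
      using g(2) by simp
  qed
  then show ?thesis by blast
qed

lemma conv_continuous:
  assumes f: "continuous_on UNIV f" and g: "g \<in> C_c 0 UNIV"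
  shows "continuous_on UNIV (conv f g)"
proof -
  obtain S where S: "compact S" "\<And>x. x \<notin> S \<Longrightarrow> g x = 0" and g': "continuous_on UNIV g"
    using g by (auto simp: C_c_def)
  have "isCont (conv f g) x0" for x0
  proof -
    obtain a b where ab: "\<And>x. x \<in> ball x0 1 \<Longrightarrow> conv f g x = integral (cbox a b) (\<lambda>y. f y * g (x - y))"
      using conv_eq_integral_cbox[OF S(1) f, of x0] g' S(2) by blast
    have "continuous_on (ball x0 1) (\<lambda>x. integral (cbox a b) (\<lambda>y. f y * g (x - y)))"
      by (intro integral_continuous_on_param)
        (auto simp: split_beta intro!: continuous_intros continuous_on_compose2[OF f] continuous_on_compose2[OF g'])
    then have "continuous_on (ball x0 1) (conv f g)"
      by (rule continuous_on_eq) (simp add: ab)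
    then show ?thesis
      by (simp add: continuous_on_eq_continuous_at)
  qed
  then show ?thesis
    by (simp add: continuous_at_imp_continuous_on)
qed

text \<open>
  Differentiation under the integral sign. The derivative falls on \<open>g\<close> alone, so convolution with a
  \<open>C\<^sup>1\<close> kernel turns continuous functions into \<open>C\<^sup>1\<close> functions.
\<close>

lemma conv_has_derivative:
  fixes g :: "'n::{finite,linorder} hspace \<Rightarrow> complex"
  assumes f: "continuous_on UNIV f" and g: "g \<in> C_c 1 UNIV" and m: "m < 4 * CARD('n)"
  shows "conv f g differentiable at x0" "xderiv m (conv f g) x0 = conv f (xderiv m g) x0"
proof -
  obtain S where S: "compact S" "\<And>x. x \<notin> S \<Longrightarrow> g x = 0" and C1: "C_on 1 UNIV g"
    using g by (auto simp: C_c_def)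
  have g0: "continuous_on UNIV g"
    using C1 by (rule C_on_imp_continuous_on)
  obtain G where G: "continuous_on UNIV G" "\<And>x. (g has_derivative blinfun_apply (G x)) (at x)"
    using C1_has_continuous_derivative[OF C1] by blast
  have xd: "xderiv m g x = blinfun_apply (G x) (xdir m)" for x
    using xderiv_eqI[OF G(2)] .
  have xd0: "continuous_on UNIV (xderiv m g)" "\<And>x. x \<notin> S \<Longrightarrow> xderiv m g x = 0"
    using C1 m xderiv_eq_0_outside[OF compact_imp_closed[OF S(1)] S(2)] by simp_all
  define P where "P x y = blinfun_mult_right (f y) o\<^sub>L G (x - y)" for x y
  obtain a b where box: "\<forall>h. continuous_on UNIV h \<longrightarrow> (\<forall>z. z \<notin> S \<longrightarrow> h z = 0) \<longrightarrow>
      (\<forall>x\<in>ball x0 1. conv f h x = integral (cbox a b) (\<lambda>y. f y * h (x - y)))"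
    using conv_eq_integral_cbox[OF S(1) f, of x0] by blast
  have ab: "x \<in> ball x0 1 \<Longrightarrow> conv f g x = integral (cbox a b) (\<lambda>y. f y * g (x - y))"
      "x \<in> ball x0 1 \<Longrightarrow> conv f (xderiv m g) x = integral (cbox a b) (\<lambda>y. f y * xderiv m g (x - y))" for x
    using box g0 S(2) xd0 by blast+
  have contP: "continuous_on (X \<times> Y) (\<lambda>(x, y). P x y)" for X Y
    unfolding P_def split_beta
    by (intro continuous_intros bounded_linear.continuous_on[OF bounded_linear_blinfun_mult_right]
        continuous_on_compose2[OF f] continuous_on_compose2[OF G(1)]) auto
  have "((\<lambda>x. integral (cbox a b) (\<lambda>y. f y * g (x - y))) has_derivative
      blinfun_apply (integral (cbox a b) (P x0))) (at x0 within ball x0 1)"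
  proof (rule leibniz_rule[OF _ _ contP])
    fix x y
    have "((\<lambda>x. g (x - y)) has_derivative blinfun_apply (G (x - y))) (at x within ball x0 1)"
      by (rule has_derivative_compose[of "\<lambda>x. x - y" "\<lambda>h. h", OF _ G(2)]) (auto intro!: derivative_eq_intros)
    then show "((\<lambda>x. f y * g (x - y)) has_derivative blinfun_apply (P x y)) (at x within ball x0 1)"
      by (auto simp: P_def intro!: derivative_eq_intros)
    show "(\<lambda>y. f y * g (x - y)) integrable_on cbox a b"
      by (intro integrable_continuous continuous_intros continuous_on_compose2[OF f] continuous_on_compose2[OF g0]) auto
  qed auto
  then have "(conv f g has_derivative blinfun_apply (integral (cbox a b) (P x0))) (at x0 within ball x0 1)"
    by (rule has_derivative_transform[rotated 2]) (auto simp: ab)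
  then have d: "(conv f g has_derivative blinfun_apply (integral (cbox a b) (P x0))) (at x0)"
    by (simp add: at_within_open[of x0 "ball x0 1"])
  then show "conv f g differentiable at x0"
    unfolding differentiable_def by blast
  have "P x0 integrable_on cbox a b"
    using contP[of "{x0}" "cbox a b"]
    by (intro integrable_continuous) (auto dest!: continuous_on_compose2[where f = "Pair x0" and s = "cbox a b"] intro: continuous_intros)
  then have "blinfun_apply (integral (cbox a b) (P x0)) (xdir m) = integral (cbox a b) (\<lambda>y. blinfun_apply (P x0 y) (xdir m))"
    by (rule blinfun_apply_integral)
  then show "xderiv m (conv f g) x0 = conv f (xderiv m g) x0"
    using xderiv_eqI[OF d] by (simp add: ab(2) P_def xd)
qed

lemma C_on_1_conv:
  fixes g :: "'n::{finite,linorder} hspace \<Rightarrow> complex"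
  assumes "continuous_on UNIV f" "g \<in> C_c 1 UNIV"
  shows "C_on 1 UNIV (conv f g)"
proof -
  have "xderiv m (conv f g) = conv f (xderiv m g)" if "m < 4 * CARD('n)" for m
    using conv_has_derivative(2)[OF assms that] by blast
  moreover have "continuous_on UNIV (conv f (xderiv m g))" if "m < 4 * CARD('n)" for m
    using conv_continuous[OF assms(1) C_c_xderiv[of g 0 UNIV m]] assms(2) that by simp
  moreover have "conv f g differentiable at q" for q
    by (rule conv_has_derivative(1)[OF assms, of 0]) simp
  ultimately show ?thesis
    by simp
qed

text \<open>
  By translation invariance, the convolution of \<open>\<phi>\<close> with the constant 1 is constant; its derivative
  is the convolution of the derivative of \<open>\<phi>\<close> with 1.
\<close>

lemma integral_xderiv_eq_0:
  fixes \<phi> :: "'n::{finite,linorder} hspace \<Rightarrow> complex"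
  assumes "\<phi> \<in> C_c 1 UNIV" "m < 4 * CARD('n)"
  shows "(LINT q|lborel. xderiv m \<phi> q) = 0"
proof -
  have conv_1: "conv (\<lambda>_. 1) g x = (LINT q|lborel. g q)" if "continuous_on UNIV g" for x and g :: "'n hspace \<Rightarrow> complex"
    using lborel_integral_reflect[OF borel_measurable_continuous_onI[OF that]] by (simp add: conv_def)
  have C1: "C_on 1 UNIV \<phi>"
    using assms(1) by (simp add: C_c_def)
  have "conv (\<lambda>_. 1) \<phi> = (\<lambda>_. LINT q|lborel. \<phi> q)"
    using conv_1[OF C_on_imp_continuous_on[OF C1]] by blast
  then have "xderiv m (conv (\<lambda>_. 1) \<phi>) 0 = 0"
    by simp
  then have "conv (\<lambda>_. 1) (xderiv m \<phi>) 0 = 0"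
    using conv_has_derivative(2)[OF continuous_on_const assms, of 1 0] by simp
  moreover have "continuous_on UNIV (xderiv m \<phi>)"
    using C1 assms(2) by simp
  ultimately show ?thesis
    using conv_1[of "xderiv m \<phi>" 0] by simp
qed

section \<open>Mollification\<close>

definition bump :: "real \<Rightarrow> 'n::{finite,linorder} hspace \<Rightarrow> complex" where
  "bump \<epsilon> y = complex_of_real ((max 0 (\<epsilon>\<^sup>2 - y \<bullet> y))\<^sup>2)"

lemma has_real_derivative_max_0_power2:
  "((\<lambda>s. (max 0 s)\<^sup>2) has_real_derivative 2 * max 0 s) (at s)" for s :: real
proof (cases s "0 :: real" rule: linorder_cases)
  case less
  have "((\<lambda>_. 0) has_real_derivative 0) (at s)" by simp
  then have "((\<lambda>s. (max 0 s)\<^sup>2) has_real_derivative 0) (at s)"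
    by (rule has_field_derivative_transform_within_open[of _ _ _ "{..<0}"]) (use less in auto)
  then show ?thesis using less by simp
next
  case greater
  have "((\<lambda>s. s\<^sup>2) has_real_derivative 2 * s) (at s)"
    by (auto intro!: derivative_eq_intros)
  then have "((\<lambda>s. (max 0 s)\<^sup>2) has_real_derivative 2 * s) (at s)"
    by (rule has_field_derivative_transform_within_open[of _ _ _ "{0<..}"]) (use greater in auto)
  then show ?thesis using greater by simp
next
  case equal
  have "((\<lambda>h. ((max 0 (0 + h))\<^sup>2 - (max 0 0)\<^sup>2) / h) \<longlongrightarrow> 0) (at (0::real))"
  proof (rule Lim_null_comparison)
    show "\<forall>\<^sub>F h in at 0. norm (((max 0 (0 + h))\<^sup>2 - (max 0 0)\<^sup>2) / h) \<le> \<bar>h\<bar>" for h :: real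
      by (intro always_eventually) (auto simp: max_def power2_eq_square)
    show "((\<lambda>h::real. \<bar>h\<bar>) \<longlongrightarrow> 0) (at 0)"
      by (rule tendsto_eq_intros refl)+ simp
  qed
  then show ?thesis
    using equal by (simp add: DERIV_def)
qed

lemma bump_eq_0: "\<epsilon> > 0 \<Longrightarrow> norm y \<ge> \<epsilon> \<Longrightarrow> bump \<epsilon> y = 0"
  by (simp add: bump_def power2_norm_eq_inner[symmetric])

lemma bump_in_C_c:
  assumes "\<epsilon> > 0"
  shows "bump \<epsilon> \<in> C_c 1 (UNIV :: 'n::{finite,linorder} hspace set)"
proof -
  have d: "(bump \<epsilon> has_derivative (\<lambda>h. complex_of_real (- (2 * (y \<bullet> h)) * (2 * max 0 (\<epsilon>\<^sup>2 - y \<bullet> y))))) (at y)" for y :: "'n hspace"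
  proof -
    have "((\<lambda>y::'n hspace. \<epsilon>\<^sup>2 - y \<bullet> y) has_derivative (\<lambda>h. - (2 * (y \<bullet> h)))) (at y)"
      by (auto intro!: derivative_eq_intros simp: inner_commute)
    from has_derivative_compose[OF this has_real_derivative_max_0_power2[unfolded has_field_derivative_def]]
    have "((\<lambda>y::'n hspace. (max 0 (\<epsilon>\<^sup>2 - y \<bullet> y))\<^sup>2) has_derivative (\<lambda>h. - (2 * (y \<bullet> h)) * (2 * max 0 (\<epsilon>\<^sup>2 - y \<bullet> y)))) (at y)"
      by (simp add: mult.commute)
    from has_derivative_of_real[OF this] show ?thesis
      by (simp add: bump_def[abs_def])
  qed
  then have "xderiv m (bump \<epsilon>) = (\<lambda>y::'n hspace. complex_of_real (- (2 * (y \<bullet> xdir m)) * (2 * max 0 (\<epsilon>\<^sup>2 - y \<bullet> y))))" for m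
    using xderiv_eqI by blast
  moreover have "continuous_on UNIV (\<lambda>y::'n hspace. complex_of_real (- (2 * (y \<bullet> xdir m)) * (2 * max 0 (\<epsilon>\<^sup>2 - y \<bullet> y))))" for m
    by (intro continuous_intros)
  moreover have "bump \<epsilon> differentiable at y" for y :: "'n hspace"
    using d differentiable_def by blast
  ultimately have "C_on 1 (UNIV :: 'n hspace set) (bump \<epsilon>)"
    by simp
  moreover have "bump \<epsilon> y = 0" if "y \<notin> cball 0 \<epsilon>" for y :: "'n hspace"
    using that bump_eq_0[OF assms, of y] by simp
  ultimately show ?thesis
    unfolding C_c_def using compact_cball by blast
qed

lemma bump_integrable:
  assumes "\<epsilon> > 0" "continuous_on UNIV f"
  shows "integrable lborel (\<lambda>y. f y * bump \<epsilon> y)"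
  using C_c_integrable[OF open_UNIV assms(2) bump_in_C_c[OF assms(1)]] by (simp add: set_integrable_def)

text \<open>
  The integral of the bump as a real number: the bump is nonnegative, but complex-valued as all
  functions here. The type argument carries the dimension.
\<close>

definition bump_mass :: "'n::{finite,linorder} itself \<Rightarrow> real \<Rightarrow> real" where
  "bump_mass _ \<epsilon> = (LINT y|lborel. norm (bump \<epsilon> (y :: 'n hspace)))"

lemma bump_norm_integrable: "\<epsilon> > 0 \<Longrightarrow> integrable lborel (\<lambda>y. norm (bump \<epsilon> y))"
  using bump_integrable[of \<epsilon> "\<lambda>_. 1"] by (intro integrable_norm) simp

lemma bump_mass_pos:
  assumes "\<epsilon> > 0"
  shows "bump_mass TYPE('n::{finite,linorder}) \<epsilon> > 0"
proof -
  define B where "B = ball (0 :: 'n hspace) (\<epsilon> / 2)"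
  have "0 < measure lborel B * (3 / 4 * \<epsilon>\<^sup>2)\<^sup>2"
    using content_ball_pos[of "\<epsilon> / 2" "0 :: 'n hspace"] assms by (simp add: B_def)
  also have "\<dots> = (LINT y|lborel. indicator B y * (3 / 4 * \<epsilon>\<^sup>2)\<^sup>2)"
    by (simp add: B_def)
  also have "\<dots> \<le> bump_mass TYPE('n) \<epsilon>"
    unfolding bump_mass_def
  proof (rule integral_mono)
    have "emeasure lborel B < \<infinity>"
      unfolding B_def by (rule emeasure_bounded_finite) simp
    then show "integrable lborel (\<lambda>y. indicator B y * (3 / 4 * \<epsilon>\<^sup>2)\<^sup>2)"
      by (intro integrable_mult_left integrable_real_indicator) (auto simp: B_def)
    show "integrable lborel (\<lambda>y::'n hspace. norm (bump \<epsilon> y))"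
      by (rule bump_norm_integrable[OF assms])
    fix y :: "'n hspace"
    have "(3 / 4 * \<epsilon>\<^sup>2)\<^sup>2 \<le> (max 0 (\<epsilon>\<^sup>2 - y \<bullet> y))\<^sup>2" if "y \<in> B"
    proof -
      have "(norm y)\<^sup>2 \<le> (\<epsilon> / 2)\<^sup>2"
        using that by (intro power_mono) (auto simp: B_def)
      then have "3 / 4 * \<epsilon>\<^sup>2 \<le> \<epsilon>\<^sup>2 - y \<bullet> y"
        by (simp add: power2_norm_eq_inner power_divide)
      then have "3 / 4 * \<epsilon>\<^sup>2 \<le> max 0 (\<epsilon>\<^sup>2 - y \<bullet> y)"
        by (rule max.coboundedI2)
      then show ?thesis
        by (intro power_mono) simp_all
    qed
    then show "indicator B y * (3 / 4 * \<epsilon>\<^sup>2)\<^sup>2 \<le> norm (bump \<epsilon> y)"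
      by (auto simp: indicator_def bump_def norm_power)
  qed
  finally show ?thesis .
qed

lemma bump_integral:
  "(LINT y|lborel. bump \<epsilon> (y :: 'n::{finite,linorder} hspace)) = complex_of_real (bump_mass TYPE('n) \<epsilon>)"
proof -
  have "bump \<epsilon> y = complex_of_real (norm (bump \<epsilon> y))" for y :: "'n hspace"
    by (simp add: bump_def norm_power)
  then have "(LINT y|lborel. bump \<epsilon> (y :: 'n hspace)) = (LINT y|lborel. complex_of_real (norm (bump \<epsilon> (y :: 'n hspace))))"
    by (rule Bochner_Integration.integral_cong[OF refl])
  then show ?thesis
    by (simp add: bump_mass_def)
qed

text \<open>
  Estimate for averages with respect to the bump, which only see the ball of radius \<open>\<epsilon>\<close>. It gives
  both the uniform bound and the convergence of mollified functions.
\<close>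

lemma bump_average_bound:
  fixes f :: "'n::{finite,linorder} hspace \<Rightarrow> complex"
  assumes "\<epsilon> > 0" "continuous_on UNIV f" "\<And>y. norm y < \<epsilon> \<Longrightarrow> norm (f y) \<le> \<eta>"
  shows "norm (LINT y|lborel. f y * bump \<epsilon> y) \<le> \<eta> * bump_mass TYPE('n) \<epsilon>"
proof -
  have "norm (LINT y|lborel. f y * bump \<epsilon> y) \<le> (LINT y|lborel. \<eta> * norm (bump \<epsilon> (y :: 'n hspace)))"
  proof (rule Bochner_Integration.integral_norm_bound_integral)
    show "integrable lborel (\<lambda>y. f y * bump \<epsilon> y)"
      by (rule bump_integrable[OF assms(1,2)])
    show "integrable lborel (\<lambda>y::'n hspace. \<eta> * norm (bump \<epsilon> y))"
      by (intro integrable_mult_right bump_norm_integrable[OF assms(1)])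
    show "norm (f y * bump \<epsilon> y) \<le> \<eta> * norm (bump \<epsilon> y)" for y
      using assms(3)[of y] bump_eq_0[OF assms(1), of y]
      by (cases "norm y < \<epsilon>") (auto simp: norm_mult intro: mult_right_mono)
  qed
  then show ?thesis
    by (simp add: bump_mass_def)
qed

definition mollify :: "real \<Rightarrow> ('n::{finite,linorder} hspace \<Rightarrow> complex) \<Rightarrow> 'n hspace \<Rightarrow> complex" where
  "mollify \<epsilon> f x = complex_of_real (1 / bump_mass TYPE('n) \<epsilon>) * conv f (bump \<epsilon>) x"

lemma mollify_eq:
  fixes f :: "'n::{finite,linorder} hspace \<Rightarrow> complex"
  assumes "\<epsilon> > 0" "continuous_on UNIV f"
  shows "mollify \<epsilon> f x = (LINT y|lborel. f (x - y) * bump \<epsilon> y) / bump_mass TYPE('n) \<epsilon>"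
proof -
  have "continuous_on UNIV (bump \<epsilon> :: 'n hspace \<Rightarrow> complex)"
    using bump_in_C_c[OF assms(1)] by (auto simp: C_c_def intro: C_on_imp_continuous_on simp del: C_on.simps One_nat_def)
  then show ?thesis
    using conv_commute[OF assms(2), of "bump \<epsilon>" x] by (simp add: mollify_def conv_def mult.commute)
qed

lemma mollify_bound:
  assumes "\<epsilon> > 0" "continuous_on UNIV f" "\<And>x. norm (f x) \<le> B"
  shows "norm (mollify \<epsilon> f x) \<le> B"
proof -
  have "norm (LINT y|lborel. f (x - y) * bump \<epsilon> y) \<le> B * bump_mass TYPE('a) \<epsilon>"
    using assms by (intro bump_average_bound continuous_on_compose2[OF assms(2)] continuous_intros) auto
  then show ?thesis
    using bump_mass_pos[OF assms(1), where 'n = 'a]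
    by (simp add: mollify_eq[OF assms(1,2)] norm_divide divide_le_eq)
qed

lemma mollify_tendsto:
  assumes f: "continuous_on UNIV f" and \<epsilon>: "\<And>i. \<epsilon> i > 0" "\<epsilon> \<longlonglongrightarrow> 0"
  shows "(\<lambda>i. mollify (\<epsilon> i) f x) \<longlonglongrightarrow> f x"
proof (rule tendstoI)
  fix e :: real assume "e > 0"
  then obtain d where d: "d > 0" "\<And>y. dist y x < d \<Longrightarrow> dist (f y) (f x) < e / 2"
    using f unfolding continuous_on_iff by (metis UNIV_I half_gt_zero)
  have "dist (mollify (\<epsilon> i) f x) (f x) < e" if "\<epsilon> i < d" for i
  proof -
    define c where "c = bump_mass TYPE('a) (\<epsilon> i)"
    have c: "c > 0"
      unfolding c_def by (rule bump_mass_pos[OF \<epsilon>(1)])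
    have fx: "continuous_on UNIV (\<lambda>y. f (x - y))"
      by (intro continuous_on_compose2[OF f] continuous_intros) auto
    have "(LINT y|lborel. (f (x - y) - f x) * bump (\<epsilon> i) y) =
        (LINT y|lborel. f (x - y) * bump (\<epsilon> i) y) - f x * c"
      using bump_integrable[OF \<epsilon>(1)[of i] fx] bump_integrable[OF \<epsilon>(1)[of i], of "\<lambda>_ :: 'a hspace. f x"]
      by (simp add: left_diff_distrib bump_integral c_def)
    then have "mollify (\<epsilon> i) f x - f x = (LINT y|lborel. (f (x - y) - f x) * bump (\<epsilon> i) y) / c"
      using c by (simp add: mollify_eq[OF \<epsilon>(1) f] c_def[symmetric] field_simps)
    moreover have "norm (LINT y|lborel. (f (x - y) - f x) * bump (\<epsilon> i) y) \<le> e / 2 * c"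
      unfolding c_def
    proof (rule bump_average_bound[OF \<epsilon>(1)])
      show "continuous_on UNIV (\<lambda>y. f (x - y) - f x)"
        by (intro continuous_intros fx)
      show "norm (f (x - y) - f x) \<le> e / 2" if "norm y < \<epsilon> i" for y
        using d(2)[of "x - y"] that \<open>\<epsilon> i < d\<close> by (simp add: dist_norm)
    qed
    ultimately have "dist (mollify (\<epsilon> i) f x) (f x) \<le> e / 2"
      using c by (simp add: dist_norm norm_divide divide_le_eq)
    then show ?thesis using \<open>e > 0\<close> by simp
  qed
  moreover have "\<forall>\<^sub>F i in sequentially. \<epsilon> i < d"
    using \<epsilon>(2) d(1) by (rule order_tendstoD)
  ultimately show "\<forall>\<^sub>F i in sequentially. dist (mollify (\<epsilon> i) f x) (f x) < e"
    by (auto elim: eventually_mono)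
qed

text \<open>
  Since convolution is commutative, the derivative can be moved to \<open>\<phi>\<close> as well as to the kernel.
\<close>

lemma mollify_xderiv:
  fixes \<phi> :: "'n::{finite,linorder} hspace \<Rightarrow> complex"
  assumes "\<epsilon> > 0" "\<phi> \<in> C_c 1 UNIV" "m < 4 * CARD('n)"
  shows "mollify \<epsilon> \<phi> differentiable at x" "xderiv m (mollify \<epsilon> \<phi>) x = mollify \<epsilon> (xderiv m \<phi>) x"
proof -
  have b: "continuous_on UNIV (bump \<epsilon> :: 'n hspace \<Rightarrow> complex)"
    using bump_in_C_c[OF assms(1)] by (auto simp: C_c_def intro: C_on_imp_continuous_on simp del: C_on.simps One_nat_def)
  have \<phi>: "continuous_on UNIV \<phi>" "continuous_on UNIV (xderiv m \<phi>)"
    using assms(2,3) C_on_imp_continuous_on[of 1 UNIV \<phi>] by (auto simp: C_c_def)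
  have eq: "mollify \<epsilon> \<phi> = (\<lambda>x. complex_of_real (1 / bump_mass TYPE('n) \<epsilon>) * conv (bump \<epsilon>) \<phi> x)"
    using conv_commute[OF \<phi>(1) b] by (simp add: mollify_def fun_eq_iff)
  have d: "conv (bump \<epsilon>) \<phi> differentiable at x"
    by (rule conv_has_derivative(1)[OF b assms(2,3)])
  then show "mollify \<epsilon> \<phi> differentiable at x"
    unfolding eq by (intro differentiable_mult) auto
  show "xderiv m (mollify \<epsilon> \<phi>) x = mollify \<epsilon> (xderiv m \<phi>) x"
    unfolding eq xderiv_cmult[OF d] conv_has_derivative(2)[OF b assms(2,3)]
    using conv_commute[OF \<phi>(2) b] by (simp add: mollify_def)
qed

text \<open>
  One derivative is put on \<open>\<phi>\<close> and the second one on the kernel, so a \<open>C\<^sup>1\<close> kernel suffices.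
\<close>

lemma C_on_2_mollify:
  fixes \<phi> :: "'n::{finite,linorder} hspace \<Rightarrow> complex"
  assumes "\<epsilon> > 0" "\<phi> \<in> C_c 1 UNIV"
  shows "C_on 2 UNIV (mollify \<epsilon> \<phi>)"
proof -
  have "C_on 1 UNIV (mollify \<epsilon> (xderiv m \<phi>))" if "m < 4 * CARD('n)" for m
    unfolding mollify_def[abs_def] using assms that
    by (intro C_on_mult C_on_const C_on_1_conv bump_in_C_c) (auto simp: C_c_def)
  moreover have "xderiv m (mollify \<epsilon> \<phi>) = mollify \<epsilon> (xderiv m \<phi>)" if "m < 4 * CARD('n)" for m
    using mollify_xderiv(2)[OF assms that] by blast
  moreover have "mollify \<epsilon> \<phi> differentiable at x" for x
    by (rule mollify_xderiv(1)[OF assms, of 0]) simp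
  ultimately show ?thesis
    by (simp add: numeral_2_eq_2)
qed

text \<open>
  Mollification with radius tending to 0. The coefficient \<open>F\<close> is only continuous, so that
  derivatives cannot be moved to it; dominated convergence is applied to the derivatives of the
  mollified functions.
\<close>

lemma C_c_1_weak_approximation:
  fixes \<phi> :: "'n::{finite,linorder} hspace \<Rightarrow> complex"
  assumes "open \<Omega>" "\<phi> \<in> C_c 1 \<Omega>"
  shows "\<exists>\<psi>. (\<forall>i::nat. \<psi> i \<in> C_c 2 \<Omega>) \<and>
    (\<forall>F j \<alpha>. continuous_on \<Omega> F \<longrightarrow> j < 2 * CARD('n) \<longrightarrow>
      (\<lambda>i. LINT q:\<Omega>|lborel. F q * nabla j \<alpha> (\<psi> i) q) \<longlonglongrightarrow> (LINT q:\<Omega>|lborel. F q * nabla j \<alpha> \<phi> q))"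
proof -
  obtain S where S: "compact S" "S \<subseteq> \<Omega>" "\<And>q. q \<notin> S \<Longrightarrow> \<phi> q = 0"
    using assms(2) by (auto simp: C_c_def)
  have \<phi>: "\<phi> \<in> C_c 1 UNIV" "\<phi> differentiable at q" for q
    using assms(2) by (auto simp: C_c_def)
  obtain \<delta> where \<delta>: "\<delta> > 0" "(\<Union>x\<in>S. cball x \<delta>) \<subseteq> \<Omega>"
    using compact_subset_open_imp_cball_epsilon_subset[OF S(1) assms(1) S(2)] by blast
  \<comment> \<open>A common compact set for the supports of all the mollified functions.\<close>
  define T where "T = {x + y | x y. x \<in> S \<and> y \<in> cball 0 \<delta>}"
  have T: "compact T" "T \<subseteq> \<Omega>"
  proof -
    show "compact T"
      unfolding T_def using S(1) by (intro compact_sums) auto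
    show "T \<subseteq> \<Omega>"
      using \<delta>(2) by (force simp: T_def dist_norm)
  qed
  define \<epsilon> where "\<epsilon> i = \<delta> / real (Suc i)" for i
  have \<epsilon>: "\<epsilon> i > 0" "\<epsilon> i \<le> \<delta>" for i
    using \<delta>(1) by (auto simp: \<epsilon>_def field_simps)
  have \<epsilon>0: "\<epsilon> \<longlonglongrightarrow> 0"
    unfolding \<epsilon>_def using LIMSEQ_Suc[OF lim_const_over_n[of \<delta>]] by simp
  define \<psi> where "\<psi> i = mollify (\<epsilon> i) \<phi>" for i
  have \<psi>0: "\<psi> i x = 0" if "x \<notin> T" for i x
  proof -
    have "(\<lambda>y. \<phi> y * bump (\<epsilon> i) (x - y)) = (\<lambda>_. 0)"
    proof
      fix y
      show "\<phi> y * bump (\<epsilon> i) (x - y) = 0"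
      proof (cases "y \<in> S")
        case True
        have "x - y \<notin> cball 0 \<delta>"
        proof
          assume "x - y \<in> cball 0 \<delta>"
          then have "y + (x - y) \<in> T"
            using True unfolding T_def by blast
          then show False using that by simp
        qed
        then have "norm (x - y) \<ge> \<epsilon> i"
          using \<epsilon>(2)[of i] by simp
        then show ?thesis
          using bump_eq_0[OF \<epsilon>(1), of i "x - y"] by simp
      qed (simp add: S(3))
    qed
    then show ?thesis
      unfolding \<psi>_def mollify_def conv_def by simp
  qed
  have \<psi>: "\<psi> i \<in> C_c 2 \<Omega>" for i
    unfolding C_c_def using C_on_2_mollify[OF \<epsilon>(1) \<phi>(1)] \<psi>0 T unfolding \<psi>_def by blast
  have xd: "xderiv m (\<psi> i) x = mollify (\<epsilon> i) (xderiv m \<phi>) x" if "m < 4 * CARD('n)" for m i x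
    unfolding \<psi>_def by (rule mollify_xderiv(2)[OF \<epsilon>(1) \<phi>(1) that])
  have cont: "continuous_on UNIV (xderiv m \<phi>)" if "m < 4 * CARD('n)" for m
    using \<phi>(1) that by (simp add: C_c_def)
  have lim: "(\<lambda>i. xderiv m (\<psi> i) x) \<longlonglongrightarrow> xderiv m \<phi> x" if "m < 4 * CARD('n)" for m x
    unfolding xd[OF that] by (rule mollify_tendsto[OF cont[OF that] \<epsilon>(1) \<epsilon>0])
  have bound: "\<exists>B. \<forall>i x. norm (xderiv m (\<psi> i) x) \<le> B" if "m < 4 * CARD('n)" for m
  proof -
    have "compact (xderiv m \<phi> ` S)"
      using cont[OF that] S(1) by (intro compact_continuous_image) (auto intro: continuous_on_subset)
    from compact_imp_bounded[OF this] obtain B where "\<forall>z\<in>xderiv m \<phi> ` S. norm z \<le> B"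
      unfolding bounded_iff by blast
    then have B: "norm (xderiv m \<phi> x) \<le> B" if "x \<in> S" for x
      using that by blast
    have "xderiv m \<phi> x = 0" if "x \<notin> S" for x
      by (rule xderiv_eq_0_outside[OF compact_imp_closed[OF S(1)] S(3) that])
    then have "norm (xderiv m \<phi> x) \<le> max 0 B" for x
      using B[of x] by (cases "x \<in> S") auto
    then show ?thesis
      unfolding xd[OF that] using mollify_bound[OF \<epsilon>(1) cont[OF that]] by blast
  qed
  have "(\<lambda>i. LINT q:\<Omega>|lborel. F q * nabla j \<alpha> (\<psi> i) q) \<longlonglongrightarrow> (LINT q:\<Omega>|lborel. F q * nabla j \<alpha> \<phi> q)"
    if F: "continuous_on \<Omega> F" and j: "j < 2 * CARD('n)" for F j \<alpha>
  proof -
    obtain c d m m' where m: "m < 4 * CARD('n)" "m' < 4 * CARD('n)"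
        and eq: "\<forall>D. nabla_comb j \<alpha> D = c * D m + d * D m'"
      using nabla_comb_two_terms[OF j, of \<alpha>] by blast
    obtain B where B: "\<forall>i x. norm (xderiv m (\<psi> i) x) \<le> B"
      using bound[OF m(1)] by (rule exE)
    obtain B' where B': "\<forall>i x. norm (xderiv m' (\<psi> i) x) \<le> B'"
      using bound[OF m(2)] by (rule exE)
    define C where "C = norm c * B + norm d * B'"
    have nabla_bound: "norm (nabla j \<alpha> (\<psi> i) x) \<le> C" for i x
      unfolding nabla_def eq[rule_format] C_def
      by (intro order_trans[OF norm_triangle_ineq] add_mono) (simp_all add: norm_mult mult_left_mono B B')
    have nabla_0: "nabla j \<alpha> (\<psi> i) x = 0" if "x \<notin> T" for i x
      unfolding nabla_def using xderiv_eq_0_outside[OF compact_imp_closed[OF T(1)] \<psi>0 that] by simp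
    have meas: "(\<lambda>q. indicator \<Omega> q *\<^sub>R (F q * nabla j \<alpha> g q)) \<in> borel_measurable lborel" if "g \<in> C_c 1 \<Omega>" for g
    proof -
      have "nabla j \<alpha> g \<in> C_c 0 \<Omega>"
        using that j by (intro C_c_nabla) simp_all
      from C_c_integrable[OF assms(1) F this] show ?thesis
        by (simp add: set_integrable_def)
    qed
    show ?thesis
      unfolding set_lebesgue_integral_def
    proof (rule integral_dominated_convergence[where w = "\<lambda>q. indicator T q *\<^sub>R (norm (F q) * C)"])
      show "(\<lambda>q. indicator \<Omega> q *\<^sub>R (F q * nabla j \<alpha> \<phi> q)) \<in> borel_measurable lborel"
        by (rule meas[OF assms(2)])
      show "(\<lambda>q. indicator \<Omega> q *\<^sub>R (F q * nabla j \<alpha> (\<psi> i) q)) \<in> borel_measurable lborel" for i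
        using \<psi>[of i] by (intro meas C_c_antimono[of _ 1]) (simp only: Suc_1)
      show "integrable lborel (\<lambda>q. indicator T q *\<^sub>R (norm (F q) * C))"
        using F T by (intro borel_integrable_compact continuous_intros) (auto intro: continuous_on_subset)
      have "(\<lambda>i. nabla j \<alpha> (\<psi> i) q) \<longlonglongrightarrow> nabla j \<alpha> \<phi> q" for q
        unfolding nabla_def eq[rule_format] by (intro tendsto_intros lim m)
      then show "AE q in lborel. (\<lambda>i. indicator \<Omega> q *\<^sub>R (F q * nabla j \<alpha> (\<psi> i) q))
          \<longlonglongrightarrow> indicator \<Omega> q *\<^sub>R (F q * nabla j \<alpha> \<phi> q)"
        by (intro always_eventually allI tendsto_intros)
      show "AE q in lborel. norm (indicator \<Omega> q *\<^sub>R (F q * nabla j \<alpha> (\<psi> i) q)) \<le> indicator T q *\<^sub>R (norm (F q) * C)" for i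
        using nabla_bound nabla_0 T(2)
        by (intro always_eventually allI) (auto simp: indicator_def norm_mult mult_left_mono)
    qed
  qed
  then show ?thesis
    using \<psi> by blast
qed

section \<open>Closed forms with continuous coefficients\<close>

lemma dist_of_form_cong:
  assumes "\<And>q K. q \<in> \<Omega> \<Longrightarrow> F q K = G q K"
  shows "dist_of_form \<Omega> F = dist_of_form \<Omega> G"
  unfolding dist_of_form_def dist_of_fun_def set_lebesgue_integral_def
  by (intro ext Bochner_Integration.integral_cong refl) (auto simp: indicator_def assms)

text \<open>
  Continuity is required on \<open>\<Omega>\<close> only, but the restriction on the indices everywhere: the
  operators involve only \<open>\<omega>\<^sup>0\<close> to \<open>\<omega>\<^sup>2\<^sup>n\<^sup>-\<^sup>1\<close>.
\<close>

definition continuous_form :: "'n::{finite,linorder} hspace set \<Rightarrow> 'n form \<Rightarrow> bool" where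
  "continuous_form \<Omega> F \<longleftrightarrow> (\<forall>I. continuous_on \<Omega> (\<lambda>q. F q I)) \<and> (\<forall>q. ext_in (2 * CARD('n)) (F q))"

text \<open>
  For fixed \<open>\<phi>\<close> the coefficients \<open>\<integral> F\<^sub>K \<phi>\<close> form an element of the exterior algebra again, and the
  linear operations on forms commute with this evaluation.
\<close>

definition pairing :: "'n::{finite,linorder} hspace set \<Rightarrow> 'n form \<Rightarrow> ('n hspace \<Rightarrow> complex) \<Rightarrow> ext" where
  "pairing \<Omega> F \<phi> = (\<lambda>K. dist_of_form \<Omega> F K \<phi>)"

lemma pairing_eq: "pairing \<Omega> F \<phi> K = (LINT q:\<Omega>|lborel. F q K * \<phi> q)"
  by (simp add: pairing_def dist_of_form_def dist_of_fun_def)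

lemma pairing_integrable:
  assumes "open \<Omega>" "continuous_form \<Omega> F" "\<phi> \<in> C_c k \<Omega>"
  shows "set_integrable lborel \<Omega> (\<lambda>q. F q K * \<phi> q)"
  using assms by (intro C_c_integrable) (auto simp: continuous_form_def)

lemma pairing_ext_in: "continuous_form \<Omega> F \<Longrightarrow> ext_in (2 * CARD('n)) (pairing \<Omega> F \<phi>)"
  for \<Omega> :: "'n::{finite,linorder} hspace set"
proof -
  assume F: "continuous_form \<Omega> F"
  have "pairing \<Omega> F \<phi> K = 0" if "\<not> K \<subseteq> {..<2 * CARD('n)}" for K
  proof -
    have "F q K = 0" for q
      using F that by (auto simp: continuous_form_def ext_in_def)
    then show ?thesis by (simp add: pairing_eq)
  qed
  then show ?thesis by (auto simp: ext_in_def)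
qed

lemma pairing_cong: "(\<And>q. q \<in> \<Omega> \<Longrightarrow> \<phi> q = \<psi> q) \<Longrightarrow> pairing \<Omega> F \<phi> = pairing \<Omega> F \<psi>"
  unfolding pairing_eq fun_eq_iff set_lebesgue_integral_def
  by (intro allI Bochner_Integration.integral_cong refl) (auto simp: indicator_def)

lemma pairing_scale: "pairing \<Omega> (f \<cdot>\<^sub>f F) \<phi> = pairing \<Omega> F (\<lambda>q. f q * \<phi> q)"
  by (simp add: pairing_eq scale_form_def fun_eq_iff ac_simps)

lemma pairing_ext_wedge_omega:
  "pairing \<Omega> (\<lambda>q. ext_wedge (omega {k}) (F q)) \<phi> = ext_wedge (omega {k}) (pairing \<Omega> F \<phi>)"
  by (auto simp: pairing_eq ext_wedge_omega_single fun_eq_iff mult.assoc)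

lemma set_integral_sum_complex:
  fixes f :: "'i \<Rightarrow> 'a \<Rightarrow> complex"
  assumes "\<And>i. i \<in> A \<Longrightarrow> set_integrable M S (f i)"
  shows "(LINT q:S|M. \<Sum>i\<in>A. f i q) = (\<Sum>i\<in>A. LINT q:S|M. f i q)"
  using assms unfolding set_integrable_def set_lebesgue_integral_def scaleR_sum_right
  by (intro Bochner_Integration.integral_sum) auto

lemma pairing_sum:
  assumes "open \<Omega>" "\<And>i. i \<in> A \<Longrightarrow> continuous_form \<Omega> (F i)" "\<phi> \<in> C_c k \<Omega>"
  shows "pairing \<Omega> (\<lambda>q K. \<Sum>i\<in>A. F i q K) \<phi> K = (\<Sum>i\<in>A. pairing \<Omega> (F i) \<phi> K)"
  unfolding pairing_eq sum_distrib_right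
  by (intro set_integral_sum_complex pairing_integrable[OF assms(1) assms(2) assms(3)])

lemma continuous_form_sum:
  assumes "\<And>i. i \<in> A \<Longrightarrow> continuous_form \<Omega> (F i)"
  shows "continuous_form \<Omega> (\<lambda>q K. \<Sum>i\<in>A. F i q K)"
  using assms ext_in_sum[of A _ "\<lambda>i. F i _" "\<lambda>_. 1"]
  by (auto simp: continuous_form_def intro!: continuous_on_sum)

lemma continuous_form_scale:
  assumes "continuous_on \<Omega> f" "continuous_form \<Omega> F"
  shows "continuous_form \<Omega> (f \<cdot>\<^sub>f F)"
  using assms by (auto simp: continuous_form_def scale_form_def ext_in_def intro!: continuous_on_mult)

lemma continuous_form_ext_wedge_omega:
  fixes F :: "'n::{finite,linorder} form"
  assumes "continuous_form \<Omega> F" "k < 2 * CARD('n)"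
  shows "continuous_form \<Omega> (\<lambda>q. ext_wedge (omega {k}) (F q))"
  unfolding continuous_form_def
proof (intro conjI allI)
  show "continuous_on \<Omega> (\<lambda>q. ext_wedge (omega {k}) (F q) K)" for K
    using assms by (cases "finite K \<and> k \<in> K")
      (auto simp: ext_wedge_omega_single continuous_form_def intro!: continuous_intros)
  show "ext_in (2 * CARD('n)) (ext_wedge (omega {k}) (F q))" for q
    using assms by (intro ext_in_ext_wedge) (auto simp: ext_in_omega continuous_form_def)
qed

text \<open>
  All derivatives are moved to the test function, and its partial derivatives are combined under
  the integral sign; afterwards only \<open>nabla k \<alpha> \<phi>\<close> and the operators \<open>\<omega>\<^sup>k \<and>\<close> matter.
\<close>

lemma dist_dform_eq:
  fixes \<Omega> :: "'n::{finite,linorder} hspace set"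
  assumes "open \<Omega>" "continuous_form \<Omega> F" "\<phi> \<in> C_c 1 \<Omega>"
  shows "dist_dform \<alpha> (dist_of_form \<Omega> F) K \<phi> =
    - (\<Sum>k<2 * CARD('n). ext_wedge (omega {k}) (pairing \<Omega> F (nabla k \<alpha> \<phi>)) K)"
proof -
  have "dist_nabla k \<alpha> (dist_of_form \<Omega> F I) \<phi> = - pairing \<Omega> F (nabla k \<alpha> \<phi>) I"
    if k: "k < 2 * CARD('n)" for k I
  proof -
    obtain c d m m' where m: "m < 4 * CARD('n)" "m' < 4 * CARD('n)"
        and eq: "\<forall>D. nabla_comb k \<alpha> D = c * D m + d * D m'"
      using nabla_comb_two_terms[OF k, of \<alpha>] by blast
    have int: "set_integrable lborel \<Omega> (\<lambda>q. F q I * xderiv l \<phi> q)" if "l < 4 * CARD('n)" for l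
      using assms that by (intro pairing_integrable[where k = 0] C_c_xderiv) simp_all
    have "pairing \<Omega> F (nabla k \<alpha> \<phi>) I =
        (LINT q:\<Omega>|lborel. c * (F q I * xderiv m \<phi> q) + d * (F q I * xderiv m' \<phi> q))"
      by (simp add: pairing_eq nabla_def eq[rule_format] algebra_simps)
    also have "\<dots> = c * (LINT q:\<Omega>|lborel. F q I * xderiv m \<phi> q) + d * (LINT q:\<Omega>|lborel. F q I * xderiv m' \<phi> q)"
      using int[OF m(1)] int[OF m(2)] by (subst set_integral_add) simp_all
    finally show ?thesis
      by (simp add: dist_nabla_def eq[rule_format] dist_xderiv_def dist_of_form_def dist_of_fun_def)
  qed
  then have "dist_dform \<alpha> (dist_of_form \<Omega> F) K \<phi> = (\<Sum>k<2 * CARD('n). - (\<Sum>I\<in>Pow {..<2 * CARD('n)}.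
      pairing \<Omega> F (nabla k \<alpha> \<phi>) I * ext_wedge (omega {k}) (omega I) K))"
    unfolding dist_dform_def by (intro sum.cong refl) (simp add: sum_negf)
  then show ?thesis
    by (simp add: ext_wedge_omega_expand[OF pairing_ext_in[OF assms(2)]] sum_negf)
qed

lemma dist_dform_sum:
  assumes "open \<Omega>" "\<And>i. i \<in> A \<Longrightarrow> continuous_form \<Omega> (F i)" "\<phi> \<in> C_c 1 \<Omega>"
  shows "dist_dform \<alpha> (dist_of_form \<Omega> (\<lambda>q K. \<Sum>i\<in>A. F i q K)) K \<phi> =
    (\<Sum>i\<in>A. dist_dform \<alpha> (dist_of_form \<Omega> (F i)) K \<phi>)"
proof -
  have nab: "nabla k \<alpha> \<phi> \<in> C_c 0 \<Omega>" if "k < 2 * CARD('a)" for k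
    using assms(3) that by (intro C_c_nabla) simp_all
  have "pairing \<Omega> (\<lambda>q K. \<Sum>i\<in>A. F i q K) (nabla k \<alpha> \<phi>) = (\<lambda>K. \<Sum>i\<in>A. pairing \<Omega> (F i) (nabla k \<alpha> \<phi>) K)"
    if "k < 2 * CARD('a)" for k
    by (rule ext, rule pairing_sum[OF assms(1,2) nab[OF that]])
  moreover have "continuous_form \<Omega> (\<lambda>q K. \<Sum>i\<in>A. F i q K)"
    by (rule continuous_form_sum[OF assms(2)])
  ultimately have "dist_dform \<alpha> (dist_of_form \<Omega> (\<lambda>q K. \<Sum>i\<in>A. F i q K)) K \<phi> =
      - (\<Sum>k<2 * CARD('a). \<Sum>i\<in>A. ext_wedge (omega {k}) (pairing \<Omega> (F i) (nabla k \<alpha> \<phi>)) K)"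
    by (simp add: dist_dform_eq[OF assms(1) _ assms(3)] ext_wedge_omega_sum)
  also have "\<dots> = (\<Sum>i\<in>A. dist_dform \<alpha> (dist_of_form \<Omega> (F i)) K \<phi>)"
    by (subst sum.swap) (simp add: dist_dform_eq[OF assms(1) assms(2) assms(3)] sum_negf)
  finally show ?thesis .
qed

text \<open>
  \<open>d\<^sub>\<alpha> W = 0\<close> as a distribution of order one. Test functions of class \<open>C\<^sup>1\<close>, rather than smooth ones,
  make the notion stable under multiplication of \<open>\<phi>\<close> by \<open>C\<^sup>1\<close> functions.
\<close>

definition weakly_closed :: "nat \<Rightarrow> 'n::{finite,linorder} hspace set \<Rightarrow> 'n form \<Rightarrow> bool" where
  "weakly_closed \<alpha> \<Omega> W \<longleftrightarrow> continuous_form \<Omega> W \<and>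
    (\<forall>K. \<forall>\<phi>\<in>C_c 1 \<Omega>. dist_dform \<alpha> (dist_of_form \<Omega> W) K \<phi> = 0)"

text \<open>
  \<open>d\<^sub>\<alpha>(\<omega>\<^sup>k \<and> W) = - \<omega>\<^sup>k \<and> d\<^sub>\<alpha> W\<close>, because \<open>\<omega>\<^sup>k\<close> anticommutes with every \<open>\<omega>\<^sup>j\<close>.
\<close>

lemma weakly_closed_ext_wedge_omega:
  fixes W :: "'n::{finite,linorder} form"
  assumes "open \<Omega>" "weakly_closed \<alpha> \<Omega> W" "k < 2 * CARD('n)"
  shows "weakly_closed \<alpha> \<Omega> (\<lambda>q. ext_wedge (omega {k}) (W q))"
proof -
  have W: "continuous_form \<Omega> W" using assms(2) by (simp add: weakly_closed_def)
  note W' = continuous_form_ext_wedge_omega[OF W assms(3)]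
  have "dist_dform \<alpha> (dist_of_form \<Omega> (\<lambda>q. ext_wedge (omega {k}) (W q))) K \<phi> = 0" if \<phi>: "\<phi> \<in> C_c 1 \<Omega>" for K \<phi>
  proof -
    have "dist_dform \<alpha> (dist_of_form \<Omega> (\<lambda>q. ext_wedge (omega {k}) (W q))) K \<phi> =
        (\<Sum>j<2 * CARD('n). ext_wedge (omega {k}) (ext_wedge (omega {j}) (pairing \<Omega> W (nabla j \<alpha> \<phi>))) K)"
      by (simp add: dist_dform_eq[OF assms(1) W' \<phi>] pairing_ext_wedge_omega
          ext_wedge_omega_anticommute[of _ k] sum_negf)
    also have "\<dots> = ext_wedge (omega {k}) (\<lambda>K. \<Sum>j<2 * CARD('n). ext_wedge (omega {j}) (pairing \<Omega> W (nabla j \<alpha> \<phi>)) K) K"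
      by (simp add: ext_wedge_omega_sum)
    also have "(\<lambda>K. \<Sum>j<2 * CARD('n). ext_wedge (omega {j}) (pairing \<Omega> W (nabla j \<alpha> \<phi>)) K) = (\<lambda>K. 0)"
      using assms(2) \<phi> dist_dform_eq[OF assms(1) W \<phi>, of \<alpha>] by (auto simp: weakly_closed_def)
    finally show ?thesis
      by (simp only: ext_wedge_omega_zero)
  qed
  then show ?thesis
    using W' by (simp add: weakly_closed_def)
qed

text \<open>
  The product rule \<open>d\<^sub>\<alpha>(f W) = d\<^sub>\<alpha> f \<and> W\<close> for closed \<open>W\<close>: in the pairing with \<open>\<phi>\<close>, write
  \<open>f \<nabla>\<phi> = \<nabla>(f \<phi>) - (\<nabla>f) \<phi>\<close>; the first term contributes nothing, as \<open>f \<phi>\<close> is a test function for the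
  closedness of \<open>W\<close>.
\<close>

lemma dist_dform_scale:
  fixes W :: "'n::{finite,linorder} form"
  assumes "open \<Omega>" "weakly_closed \<alpha> \<Omega> W" "C_on 1 \<Omega> f" "\<phi> \<in> C_c 1 \<Omega>"
  shows "dist_dform \<alpha> (dist_of_form \<Omega> (f \<cdot>\<^sub>f W)) K \<phi> =
    dist_of_form \<Omega> (\<lambda>q K. \<Sum>j<2 * CARD('n). nabla j \<alpha> f q * ext_wedge (omega {j}) (W q) K) K \<phi>"
proof -
  have W: "continuous_form \<Omega> W" using assms(2) by (simp add: weakly_closed_def)
  have nabla_f: "continuous_on \<Omega> (nabla j \<alpha> f)" if "j < 2 * CARD('n)" for j
    using C_on_nabla[OF assms(1), of 0 f j \<alpha>] assms(3) that by simp_all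
  have f\<phi>: "(\<lambda>q. f q * \<phi> q) \<in> C_c 1 \<Omega>"
    by (rule C_c_mult[OF assms(1,3,4)])
  have fcont: "continuous_on \<Omega> f"
    by (rule C_on_imp_continuous_on[OF assms(3)])
  have split: "pairing \<Omega> (f \<cdot>\<^sub>f W) (nabla j \<alpha> \<phi>) = (\<lambda>I. pairing \<Omega> W (nabla j \<alpha> (\<lambda>q. f q * \<phi> q)) I -
      pairing \<Omega> W (\<lambda>q. nabla j \<alpha> f q * \<phi> q) I)" if j: "j < 2 * CARD('n)" for j
  proof
    fix I
    have "pairing \<Omega> (f \<cdot>\<^sub>f W) (nabla j \<alpha> \<phi>) I =
        pairing \<Omega> W (\<lambda>q. nabla j \<alpha> (\<lambda>q. f q * \<phi> q) q - nabla j \<alpha> f q * \<phi> q) I"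
      unfolding pairing_scale
      by (rule fun_cong[OF pairing_cong])
        (use assms(3) C_c_imp_differentiable[of \<phi> 0 \<Omega>] assms(4) in \<open>simp add: nabla_mult\<close>)
    also have "\<dots> = pairing \<Omega> W (nabla j \<alpha> (\<lambda>q. f q * \<phi> q)) I - pairing \<Omega> W (\<lambda>q. nabla j \<alpha> f q * \<phi> q) I"
      unfolding pairing_eq right_diff_distrib
    proof (rule set_integral_diff)
      show "set_integrable lborel \<Omega> (\<lambda>q. W q I * nabla j \<alpha> (\<lambda>q. f q * \<phi> q) q)"
        using f\<phi> j by (intro pairing_integrable[OF assms(1) W, where k = 0] C_c_nabla) simp_all
      have "\<phi> \<in> C_c 0 \<Omega>"
        using assms(4) C_c_antimono[of \<phi> 0] by simp
      then have "(\<lambda>q. nabla j \<alpha> f q * \<phi> q) \<in> C_c 0 \<Omega>"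
        using nabla_f[OF j] by (intro C_c_mult[OF assms(1)]) simp_all
      then show "set_integrable lborel \<Omega> (\<lambda>q. W q I * (nabla j \<alpha> f q * \<phi> q))"
        by (rule pairing_integrable[OF assms(1) W])
    qed
    finally show "pairing \<Omega> (f \<cdot>\<^sub>f W) (nabla j \<alpha> \<phi>) I = pairing \<Omega> W (nabla j \<alpha> (\<lambda>q. f q * \<phi> q)) I -
      pairing \<Omega> W (\<lambda>q. nabla j \<alpha> f q * \<phi> q) I" .
  qed
  have closed: "(\<Sum>j<2 * CARD('n). ext_wedge (omega {j}) (pairing \<Omega> W (nabla j \<alpha> (\<lambda>q. f q * \<phi> q))) K) = 0"
    using assms(2) f\<phi> dist_dform_eq[OF assms(1) W f\<phi>, of \<alpha> K] by (simp add: weakly_closed_def)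
  have diff: "ext_wedge (omega {j}) (\<lambda>I. a I - b I) K = ext_wedge (omega {j}) a K - ext_wedge (omega {j}) b K" for j a b
    by (simp add: ext_wedge_omega_single right_diff_distrib)
  have "dist_dform \<alpha> (dist_of_form \<Omega> (f \<cdot>\<^sub>f W)) K \<phi> =
      - (\<Sum>j<2 * CARD('n). ext_wedge (omega {j}) (pairing \<Omega> (f \<cdot>\<^sub>f W) (nabla j \<alpha> \<phi>)) K)"
    by (rule dist_dform_eq[OF assms(1) continuous_form_scale[OF fcont W] assms(4)])
  also have "\<dots> = (\<Sum>j<2 * CARD('n). ext_wedge (omega {j}) (pairing \<Omega> W (\<lambda>q. nabla j \<alpha> f q * \<phi> q)) K)"
    using closed by (simp add: split diff sum_subtractf)
  also have "\<dots> = (\<Sum>j<2 * CARD('n). pairing \<Omega> (nabla j \<alpha> f \<cdot>\<^sub>f (\<lambda>q. ext_wedge (omega {j}) (W q))) \<phi> K)"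
    by (simp add: pairing_scale pairing_ext_wedge_omega)
  also have "\<dots> = pairing \<Omega> (\<lambda>q K. \<Sum>j<2 * CARD('n). (nabla j \<alpha> f \<cdot>\<^sub>f (\<lambda>q. ext_wedge (omega {j}) (W q))) q K) \<phi> K"
    using nabla_f W by (intro pairing_sum[OF assms(1) _ assms(4), symmetric] continuous_form_scale
        continuous_form_ext_wedge_omega) auto
  finally show ?thesis
    by (simp add: pairing_def scale_form_def)
qed

lemma dform_fun_eq:
  fixes u :: "'n::{finite,linorder} hspace \<Rightarrow> complex"
  shows "dform \<beta> (form_of_fun u) q = (\<lambda>K. \<Sum>k<2 * CARD('n). nabla k \<beta> u q * omega {k} K)"
proof
  fix K
  have "(\<Sum>I\<in>Pow {..<2 * CARD('n)}. nabla k \<beta> (\<lambda>q. form_of_fun u q I) q * ext_wedge (omega {k}) (omega I) K) =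
      nabla k \<beta> u q * omega {k} K" for k
  proof -
    have "(\<Sum>I\<in>Pow {..<2 * CARD('n)}. nabla k \<beta> (\<lambda>q. form_of_fun u q I) q * ext_wedge (omega {k}) (omega I) K) =
        (\<Sum>I\<in>Pow {..<2 * CARD('n)}. if I = {} then nabla k \<beta> u q * ext_wedge (omega {k}) (omega {}) K else 0)"
      by (intro sum.cong refl) (simp add: form_of_fun_def omega_def)
    also have "\<dots> = nabla k \<beta> u q * ext_wedge (omega {k}) (omega {}) K"
      by simp
    also have "ext_wedge (omega {k}) (omega {}) K = omega {k} K"
    proof (cases "k \<in> K \<and> K - {k} = {}")
      case True
      then have "K = {k}" by blast
      then show ?thesis
        unfolding ext_wedge_omega_single by (simp add: omega_def ext_sign_def)
    next
      case False
      then have "K \<noteq> {k}" by blast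
      with False show ?thesis
        unfolding ext_wedge_omega_single by (auto simp: omega_def)
    qed
    finally show ?thesis .
  qed
  then show "dform \<beta> (form_of_fun u) q K = (\<Sum>k<2 * CARD('n). nabla k \<beta> u q * omega {k} K)"
    by (simp add: dform_def)
qed

lemma dform_fun_wedge:
  fixes u :: "'n::{finite,linorder} hspace \<Rightarrow> complex"
  shows "(dform \<beta> (form_of_fun u) \<and>\<^sub>f W) q K = (\<Sum>k<2 * CARD('n). nabla k \<beta> u q * ext_wedge (omega {k}) (W q) K)"
  by (simp add: wedge_def dform_fun_eq ext_wedge_sum_left)

lemma dform_dform_fun_eq:
  fixes u :: "'n::{finite,linorder} hspace \<Rightarrow> complex"
  assumes "open \<Omega>" "C_on 2 \<Omega> u" "q \<in> \<Omega>"
  shows "dform \<alpha> (dform \<beta> (form_of_fun u)) q = (\<lambda>K. \<Sum>j<2 * CARD('n). \<Sum>k<2 * CARD('n).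
    nabla j \<alpha> (nabla k \<beta> u) q * ext_wedge (omega {j}) (omega {k}) K)"
proof
  fix K
  have "C_on (Suc (Suc 0)) \<Omega> u"
    using assms(2) by (simp only: numeral_2_eq_2)
  note u = C_on_imp_differentiable[OF C_on_nabla[OF assms(1) this] assms(3)]
  have in_range: "ext_in (2 * CARD('n)) (\<lambda>I. \<Sum>k<2 * CARD('n). nabla j \<alpha> (nabla k \<beta> u) q * omega {k} I)" for j
    by (intro ext_in_sum) (simp add: ext_in_omega)
  have "(\<Sum>I\<in>Pow {..<2 * CARD('n)}. nabla j \<alpha> (\<lambda>q. dform \<beta> (form_of_fun u) q I) q * ext_wedge (omega {j}) (omega I) K)
      = (\<Sum>k<2 * CARD('n). nabla j \<alpha> (nabla k \<beta> u) q * ext_wedge (omega {j}) (omega {k}) K)" for j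
  proof -
    have "nabla j \<alpha> (\<lambda>q. dform \<beta> (form_of_fun u) q I) q = (\<Sum>k<2 * CARD('n). nabla j \<alpha> (nabla k \<beta> u) q * omega {k} I)" for I
      unfolding dform_fun_eq using u by (intro nabla_sum_cmult) auto
    then show ?thesis
      by (simp only: ext_wedge_omega_expand[OF in_range] ext_wedge_omega_sum ext_wedge_omega_scale)
  qed
  then show "dform \<alpha> (dform \<beta> (form_of_fun u)) q K = (\<Sum>j<2 * CARD('n). \<Sum>k<2 * CARD('n).
    nabla j \<alpha> (nabla k \<beta> u) q * ext_wedge (omega {j}) (omega {k}) K)"
    by (simp add: dform_def[of \<alpha>])
qed

lemma dform_dform_fun_wedge:
  fixes u :: "'n::{finite,linorder} hspace \<Rightarrow> complex"
  assumes "open \<Omega>" "C_on 2 \<Omega> u" "q \<in> \<Omega>"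
  shows "(dform \<alpha> (dform \<beta> (form_of_fun u)) \<and>\<^sub>f W) q K = (\<Sum>j<2 * CARD('n). \<Sum>k<2 * CARD('n).
    nabla j \<alpha> (nabla k \<beta> u) q * ext_wedge (omega {j}) (ext_wedge (omega {k}) (W q)) K)"
proof -
  have "(dform \<alpha> (dform \<beta> (form_of_fun u)) \<and>\<^sub>f W) q K = ext_wedge (\<lambda>K. \<Sum>j<2 * CARD('n). 1 * (\<Sum>k<2 * CARD('n).
    nabla j \<alpha> (nabla k \<beta> u) q * ext_wedge (omega {j}) (omega {k}) K)) (W q) K"
    by (simp add: wedge_def dform_dform_fun_eq[OF assms])
  then show ?thesis
    unfolding ext_wedge_sum_left ext_wedge_assoc by simp
qed

text \<open>
  Interchanging the two operators exchanges \<open>\<omega>\<^sup>j\<close> and \<open>\<omega>\<^sup>k\<close> and leaves the second derivatives of \<open>u\<close>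
  unchanged.
\<close>

lemma dform_dform_fun_anticommute:
  fixes u :: "'n::{finite,linorder} hspace \<Rightarrow> complex"
  assumes "open \<Omega>" "C_on 2 \<Omega> u" "q \<in> \<Omega>"
  shows "(dform \<alpha> (dform \<beta> (form_of_fun u)) \<and>\<^sub>f W) q K = - (dform \<beta> (dform \<alpha> (form_of_fun u)) \<and>\<^sub>f W) q K"
proof -
  have "(dform \<alpha> (dform \<beta> (form_of_fun u)) \<and>\<^sub>f W) q K = (\<Sum>j<2 * CARD('n). \<Sum>k<2 * CARD('n).
      - (nabla k \<beta> (nabla j \<alpha> u) q * ext_wedge (omega {k}) (ext_wedge (omega {j}) (W q)) K))"
    unfolding dform_dform_fun_wedge[OF assms]
  proof (intro sum.cong refl)
    fix j k assume "j \<in> {..<2 * CARD('n)}" "k \<in> {..<2 * CARD('n)}"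
    then show "nabla j \<alpha> (nabla k \<beta> u) q * ext_wedge (omega {j}) (ext_wedge (omega {k}) (W q)) K =
        - (nabla k \<beta> (nabla j \<alpha> u) q * ext_wedge (omega {k}) (ext_wedge (omega {j}) (W q)) K)"
      using nabla_commute[OF assms(1,3,2), of j k \<alpha> \<beta>]
        ext_wedge_omega_anticommute[of j k "W q" K] by simp
  qed
  then show ?thesis
    unfolding dform_dform_fun_wedge[OF assms] by (subst sum.swap) (simp add: sum_negf)
qed

lemma continuous_form_dform_fun_wedge:
  fixes u :: "'n::{finite,linorder} hspace \<Rightarrow> complex"
  assumes "open \<Omega>" "C_on 1 \<Omega> u" "continuous_form \<Omega> W"
  shows "continuous_form \<Omega> (dform \<beta> (form_of_fun u) \<and>\<^sub>f W)"
proof -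
  have "continuous_on \<Omega> (nabla k \<beta> u)" if "k < 2 * CARD('n)" for k
    using C_on_nabla[OF assms(1), of 0 u k \<beta>] assms(2) that by simp
  then have "continuous_form \<Omega> (\<lambda>q K. \<Sum>k<2 * CARD('n). (nabla k \<beta> u \<cdot>\<^sub>f (\<lambda>q. ext_wedge (omega {k}) (W q))) q K)"
    using assms(3) by (intro continuous_form_sum continuous_form_scale continuous_form_ext_wedge_omega) auto
  also have "(\<lambda>q K. \<Sum>k<2 * CARD('n). (nabla k \<beta> u \<cdot>\<^sub>f (\<lambda>q. ext_wedge (omega {k}) (W q))) q K) =
      dform \<beta> (form_of_fun u) \<and>\<^sub>f W"
    by (simp add: fun_eq_iff dform_fun_wedge scale_form_def)
  finally show ?thesis .
qed

lemma ext_in_dform: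
  fixes F :: "'n::{finite,linorder} form"
  shows "ext_in (2 * CARD('n)) (dform \<alpha> F q)"
proof -
  have "ext_in (2 * CARD('n)) (\<lambda>K. \<Sum>k<2 * CARD('n). 1 * (\<Sum>I\<in>Pow {..<2 * CARD('n)}.
      nabla k \<alpha> (\<lambda>q. F q I) q * ext_wedge (omega {k}) (omega I) K))"
    by (intro ext_in_sum ext_in_ext_wedge) (auto simp: ext_in_omega)
  then show ?thesis
    by (simp add: dform_def)
qed

lemma continuous_form_dform_dform_fun_wedge:
  fixes u :: "'n::{finite,linorder} hspace \<Rightarrow> complex"
  assumes "open \<Omega>" "C_on 2 \<Omega> u" "continuous_form \<Omega> W"
  shows "continuous_form \<Omega> (dform \<alpha> (dform \<beta> (form_of_fun u)) \<and>\<^sub>f W)"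
proof -
  have "continuous_on \<Omega> (nabla j \<alpha> (nabla k \<beta> u))" if "j < 2 * CARD('n)" "k < 2 * CARD('n)" for j k
  proof (rule C_on_imp_continuous_on[OF C_on_nabla[OF assms(1) C_on_nabla[OF assms(1) _ that(2)] that(1)]])
    show "C_on (Suc (Suc 0)) \<Omega> u"
      using assms(2) by (simp only: numeral_2_eq_2)
  qed
  moreover have "continuous_on \<Omega> (\<lambda>q. ext_wedge (omega {j}) (ext_wedge (omega {k}) (W q)) K)"
    if "j < 2 * CARD('n)" "k < 2 * CARD('n)" for j k K
    using continuous_form_ext_wedge_omega[OF continuous_form_ext_wedge_omega[OF assms(3) that(2)] that(1)]
    by (simp add: continuous_form_def)
  ultimately have "continuous_on \<Omega> (\<lambda>q. \<Sum>j<2 * CARD('n). \<Sum>k<2 * CARD('n).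
    nabla j \<alpha> (nabla k \<beta> u) q * ext_wedge (omega {j}) (ext_wedge (omega {k}) (W q)) K)" for K
    by (intro continuous_intros) auto
  then have "continuous_on \<Omega> (\<lambda>q. (dform \<alpha> (dform \<beta> (form_of_fun u)) \<and>\<^sub>f W) q K)" for K
    by (rule continuous_on_eq) (simp add: dform_dform_fun_wedge[OF assms(1,2)])
  moreover have "ext_in (2 * CARD('n)) ((dform \<alpha> (dform \<beta> (form_of_fun u)) \<and>\<^sub>f W) q)" for q
    using assms(3) by (auto simp: wedge_def continuous_form_def intro!: ext_in_ext_wedge ext_in_dform)
  ultimately show ?thesis
    by (simp add: continuous_form_def)
qed

text \<open>
  \<open>d\<^sub>\<beta> u \<and> W\<close> is the sum of the \<open>(\<nabla>\<^sub>k\<^sub>\<beta> u) \<omega>\<^sup>k \<and> W\<close>, each of which is a \<open>C\<^sup>1\<close> function times a closed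
  form, so that the product rule applies.
\<close>

lemma dist_dform_dform_fun_wedge:
  fixes u :: "'n::{finite,linorder} hspace \<Rightarrow> complex"
  assumes "open \<Omega>" "C_on 2 \<Omega> u" "weakly_closed \<alpha> \<Omega> W" "\<phi> \<in> C_c 1 \<Omega>"
  shows "dist_dform \<alpha> (dist_of_form \<Omega> (dform \<beta> (form_of_fun u) \<and>\<^sub>f W)) K \<phi> =
    dist_of_form \<Omega> (dform \<alpha> (dform \<beta> (form_of_fun u)) \<and>\<^sub>f W) K \<phi>"
proof -
  have W: "continuous_form \<Omega> W" using assms(3) by (simp add: weakly_closed_def)
  define V where "V k = (\<lambda>q. ext_wedge (omega {k}) (W q))" for k
  have V: "weakly_closed \<alpha> \<Omega> (V k)" if "k < 2 * CARD('n)" for k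
    unfolding V_def by (rule weakly_closed_ext_wedge_omega[OF assms(1,3) that])
  have Vc: "continuous_form \<Omega> (V k)" if "k < 2 * CARD('n)" for k
    using V[OF that] by (simp add: weakly_closed_def)
  have u: "C_on 1 \<Omega> (nabla k \<beta> u)" if "k < 2 * CARD('n)" for k
    using C_on_nabla[OF assms(1), of 1 u k \<beta>] assms(2) that by (simp only: Suc_1)
  have u0: "continuous_on \<Omega> (nabla k \<beta> u)" if "k < 2 * CARD('n)" for k
    by (rule C_on_imp_continuous_on[OF u[OF that]])
  have uc: "continuous_on \<Omega> (nabla j \<alpha> (nabla k \<beta> u))" if "j < 2 * CARD('n)" "k < 2 * CARD('n)" for j k
    using C_on_nabla[OF assms(1), of 0 "nabla k \<beta> u" j \<alpha>] u that by simp
  have "dform \<beta> (form_of_fun u) \<and>\<^sub>f W = (\<lambda>q K. \<Sum>k<2 * CARD('n). (nabla k \<beta> u \<cdot>\<^sub>f V k) q K)"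
    by (simp add: fun_eq_iff dform_fun_wedge scale_form_def V_def)
  then have "dist_dform \<alpha> (dist_of_form \<Omega> (dform \<beta> (form_of_fun u) \<and>\<^sub>f W)) K \<phi> =
      (\<Sum>k<2 * CARD('n). dist_dform \<alpha> (dist_of_form \<Omega> (nabla k \<beta> u \<cdot>\<^sub>f V k)) K \<phi>)"
    using Vc u0 by (simp only:, intro dist_dform_sum[OF assms(1) _ assms(4)] continuous_form_scale) auto
  also have "\<dots> = (\<Sum>k<2 * CARD('n). pairing \<Omega>
      (\<lambda>q K. \<Sum>j<2 * CARD('n). (nabla j \<alpha> (nabla k \<beta> u) \<cdot>\<^sub>f (\<lambda>q. ext_wedge (omega {j}) (V k q))) q K) \<phi> K)"
  proof (intro sum.cong refl)
    fix k assume "k \<in> {..<2 * CARD('n)}"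
    then have "k < 2 * CARD('n)" by simp
    from dist_dform_scale[OF assms(1) V[OF this] u[OF this] assms(4), of K]
    show "dist_dform \<alpha> (dist_of_form \<Omega> (nabla k \<beta> u \<cdot>\<^sub>f V k)) K \<phi> = pairing \<Omega>
        (\<lambda>q K. \<Sum>j<2 * CARD('n). (nabla j \<alpha> (nabla k \<beta> u) \<cdot>\<^sub>f (\<lambda>q. ext_wedge (omega {j}) (V k q))) q K) \<phi> K"
      by (simp add: pairing_def scale_form_def)
  qed
  also have "\<dots> = pairing \<Omega> (\<lambda>q K. \<Sum>k<2 * CARD('n). \<Sum>j<2 * CARD('n).
      (nabla j \<alpha> (nabla k \<beta> u) \<cdot>\<^sub>f (\<lambda>q. ext_wedge (omega {j}) (V k q))) q K) \<phi> K"
    using Vc uc by (intro pairing_sum[OF assms(1) _ assms(4), symmetric] continuous_form_sum continuous_form_scale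
      continuous_form_ext_wedge_omega) auto
  also have "\<dots> = dist_of_form \<Omega> (dform \<alpha> (dform \<beta> (form_of_fun u)) \<and>\<^sub>f W) K \<phi>"
    unfolding pairing_def
  proof (rule arg_cong[where f = "\<lambda>T. T K \<phi>"], rule dist_of_form_cong)
    fix q K assume "q \<in> \<Omega>"
    then show "(\<Sum>k<2 * CARD('n). \<Sum>j<2 * CARD('n).
        (nabla j \<alpha> (nabla k \<beta> u) \<cdot>\<^sub>f (\<lambda>q. ext_wedge (omega {j}) (V k q))) q K) =
        (dform \<alpha> (dform \<beta> (form_of_fun u)) \<and>\<^sub>f W) q K"
      by (subst sum.swap) (simp add: dform_dform_fun_wedge[OF assms(1,2)] V_def scale_form_def)
  qed
  finally show ?thesis .
qed

text \<open>
  The induction step for the outer operator, \<open>d\<^sub>\<alpha>(d\<^sub>\<alpha> d\<^sub>\<beta> u \<and> W) = d\<^sub>\<alpha> d\<^sub>\<alpha>(d\<^sub>\<beta> u \<and> W) = 0\<close>. The second equality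
  takes two derivatives of the test function, whence the detour through \<open>C\<^sup>2\<close> test functions.
\<close>

lemma weakly_closed_dform_dform_fun_wedge:
  fixes u :: "'n::{finite,linorder} hspace \<Rightarrow> complex"
  assumes "open \<Omega>" "C_on 2 \<Omega> u" "weakly_closed \<alpha> \<Omega> W"
  shows "weakly_closed \<alpha> \<Omega> (dform \<alpha> (dform \<beta> (form_of_fun u)) \<and>\<^sub>f W)"
proof -
  define U where "U = dform \<beta> (form_of_fun u) \<and>\<^sub>f W"
  define V where "V = dform \<alpha> (dform \<beta> (form_of_fun u)) \<and>\<^sub>f W"
  have W: "continuous_form \<Omega> W" using assms(3) by (simp add: weakly_closed_def)
  have "C_on 1 \<Omega> u"
    using assms(2) C_on_SucD[of 1 \<Omega> u] by (simp only: Suc_1)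
  then have U: "continuous_form \<Omega> U"
    unfolding U_def by (rule continuous_form_dform_fun_wedge[OF assms(1) _ W])
  have V: "continuous_form \<Omega> V"
    unfolding V_def by (rule continuous_form_dform_dform_fun_wedge[OF assms(1,2) W])
  have smooth: "dist_dform \<alpha> (dist_of_form \<Omega> V) K \<phi> = 0" if \<phi>: "\<phi> \<in> C_c 2 \<Omega>" for \<phi> K
  proof -
    define S where "S = (\<Sum>k<2 * CARD('n). \<Sum>j<2 * CARD('n).
      ext_wedge (omega {k}) (ext_wedge (omega {j}) (pairing \<Omega> U (nabla j \<alpha> (nabla k \<alpha> \<phi>)))) K)"
    have \<phi>1: "\<phi> \<in> C_c 1 \<Omega>"
      using \<phi> C_c_antimono[of \<phi> 1] by (simp only: Suc_1)
    have nab: "nabla k \<alpha> \<phi> \<in> C_c 1 \<Omega>" if "k < 2 * CARD('n)" for k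
      using \<phi> that C_c_nabla[of \<phi> 1] by (simp only: Suc_1)
    have "pairing \<Omega> V (nabla k \<alpha> \<phi>) = (\<lambda>I. \<Sum>j<2 * CARD('n).
        - ext_wedge (omega {j}) (pairing \<Omega> U (nabla j \<alpha> (nabla k \<alpha> \<phi>))) I)" if "k < 2 * CARD('n)" for k
    proof
      fix I
      have "pairing \<Omega> V (nabla k \<alpha> \<phi>) I = dist_dform \<alpha> (dist_of_form \<Omega> U) I (nabla k \<alpha> \<phi>)"
        unfolding pairing_def V_def U_def by (rule dist_dform_dform_fun_wedge[OF assms nab[OF that], symmetric])
      then show "pairing \<Omega> V (nabla k \<alpha> \<phi>) I = (\<Sum>j<2 * CARD('n).
          - ext_wedge (omega {j}) (pairing \<Omega> U (nabla j \<alpha> (nabla k \<alpha> \<phi>))) I)"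
        by (simp add: dist_dform_eq[OF assms(1) U nab[OF that]] sum_negf)
    qed
    moreover have "ext_wedge (omega {k}) (\<lambda>I. - a I) K = - ext_wedge (omega {k}) a K" for k a
      by (simp add: ext_wedge_omega_single)
    ultimately have "dist_dform \<alpha> (dist_of_form \<Omega> V) K \<phi> = S"
      by (simp add: dist_dform_eq[OF assms(1) V \<phi>1] ext_wedge_omega_sum sum_negf S_def)
    \<comment> \<open>\<open>\<omega>\<^sup>k\<close> and \<open>\<omega>\<^sup>j\<close> anticommute, whereas the second derivatives of \<open>\<phi>\<close> commute.\<close>
    moreover have "S = - S"
    proof -
      have "S = (\<Sum>k<2 * CARD('n). \<Sum>j<2 * CARD('n).
        - ext_wedge (omega {j}) (ext_wedge (omega {k}) (pairing \<Omega> U (nabla k \<alpha> (nabla j \<alpha> \<phi>)))) K)"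
        unfolding S_def
      proof (intro sum.cong refl)
        fix j k assume jk: "k \<in> {..<2 * CARD('n)}" "j \<in> {..<2 * CARD('n)}"
        have "nabla j \<alpha> (nabla k \<alpha> \<phi>) = nabla k \<alpha> (nabla j \<alpha> \<phi>)"
          using \<phi> jk by (intro ext nabla_commute[OF open_UNIV]) (auto simp: C_c_def simp del: C_on.simps)
        then show "ext_wedge (omega {k}) (ext_wedge (omega {j}) (pairing \<Omega> U (nabla j \<alpha> (nabla k \<alpha> \<phi>)))) K =
          - ext_wedge (omega {j}) (ext_wedge (omega {k}) (pairing \<Omega> U (nabla k \<alpha> (nabla j \<alpha> \<phi>)))) K"
          by (simp add: ext_wedge_omega_anticommute[of k j])
      qed
      also have "\<dots> = - S"
        unfolding S_def by (subst sum.swap) (simp add: sum_negf)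
      finally show ?thesis .
    qed
    ultimately show ?thesis by simp
  qed
  have "dist_dform \<alpha> (dist_of_form \<Omega> V) K \<phi> = 0" if \<phi>: "\<phi> \<in> C_c 1 \<Omega>" for \<phi> K
  proof -
    obtain \<psi> where \<psi>: "\<And>i::nat. \<psi> i \<in> C_c 2 \<Omega>"
      and lim: "\<And>F j \<alpha>. continuous_on \<Omega> F \<Longrightarrow> j < 2 * CARD('n) \<Longrightarrow>
        (\<lambda>i. LINT q:\<Omega>|lborel. F q * nabla j \<alpha> (\<psi> i) q) \<longlonglongrightarrow> (LINT q:\<Omega>|lborel. F q * nabla j \<alpha> \<phi> q)"
      using C_c_1_weak_approximation[OF assms(1) \<phi>] by blast
    have \<psi>1: "\<psi> i \<in> C_c 1 \<Omega>" for i
      using \<psi>[of i] C_c_antimono[of "\<psi> i" 1] by (simp only: Suc_1)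
    have "(\<lambda>i. ext_wedge (omega {k}) (pairing \<Omega> V (nabla k \<alpha> (\<psi> i))) K)
        \<longlonglongrightarrow> ext_wedge (omega {k}) (pairing \<Omega> V (nabla k \<alpha> \<phi>)) K" if "k < 2 * CARD('n)" for k
      using V that by (cases "finite K \<and> k \<in> K")
        (auto simp: ext_wedge_omega_single pairing_eq continuous_form_def intro!: tendsto_intros lim)
    then have "(\<lambda>i. dist_dform \<alpha> (dist_of_form \<Omega> V) K (\<psi> i)) \<longlonglongrightarrow> dist_dform \<alpha> (dist_of_form \<Omega> V) K \<phi>"
      unfolding dist_dform_eq[OF assms(1) V \<psi>1] dist_dform_eq[OF assms(1) V \<phi>]
      by (intro tendsto_intros) auto
    then show ?thesis
      using smooth[OF \<psi>] LIMSEQ_unique[OF _ tendsto_const[of 0]] by simp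
  qed
  then show ?thesis
    using V unfolding V_def weakly_closed_def by blast
qed

text \<open>
  The induction step for the inner operator, which becomes the outer one after anticommuting.
\<close>

lemma weakly_closed_dform_dform_fun_wedge_swapped:
  fixes u :: "'n::{finite,linorder} hspace \<Rightarrow> complex"
  assumes "open \<Omega>" "C_on 2 \<Omega> u" "weakly_closed \<beta> \<Omega> W"
  shows "weakly_closed \<beta> \<Omega> (dform \<alpha> (dform \<beta> (form_of_fun u)) \<and>\<^sub>f W)"
proof -
  have W: "continuous_form \<Omega> W" using assms(3) by (simp add: weakly_closed_def)
  define V where "V = dform \<beta> (dform \<alpha> (form_of_fun u)) \<and>\<^sub>f W"
  have V: "weakly_closed \<beta> \<Omega> V"
    unfolding V_def by (rule weakly_closed_dform_dform_fun_wedge[OF assms])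
  have "dist_of_form \<Omega> (dform \<alpha> (dform \<beta> (form_of_fun u)) \<and>\<^sub>f W) = dist_of_form \<Omega> ((\<lambda>_. -1) \<cdot>\<^sub>f V)"
    by (rule dist_of_form_cong) (simp add: V_def scale_form_def dform_dform_fun_anticommute[OF assms(1,2), of _ \<alpha> \<beta>])
  moreover have "dist_dform \<beta> (dist_of_form \<Omega> ((\<lambda>_. -1) \<cdot>\<^sub>f V)) K \<phi> = 0" if "\<phi> \<in> C_c 1 \<Omega>" for K \<phi>
    using dist_dform_scale[OF assms(1) V C_on_const that] by (simp add: dist_of_form_def dist_of_fun_def)
  ultimately show ?thesis
    using continuous_form_dform_dform_fun_wedge[OF assms(1,2) W] by (simp add: weakly_closed_def)
qed

lemma weakly_closed_one:
  fixes \<Omega> :: "'n::{finite,linorder} hspace set"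
  assumes "open \<Omega>"
  shows "weakly_closed \<alpha> \<Omega> (form_of_fun (\<lambda>_. 1))"
proof -
  have 1: "continuous_form \<Omega> (form_of_fun (\<lambda>_. 1))"
    using ext_in_omega[of "2 * CARD('n)" "{}"] by (simp add: continuous_form_def form_of_fun_def)
  have "pairing \<Omega> (form_of_fun (\<lambda>_. 1)) (nabla k \<alpha> \<phi>) = (\<lambda>_. 0)"
    if \<phi>: "\<phi> \<in> C_c 1 \<Omega>" and k: "k < 2 * CARD('n)" for \<phi> k
  proof
    fix I
    obtain S where S: "compact S" "S \<subseteq> \<Omega>" "\<And>q. q \<notin> S \<Longrightarrow> \<phi> q = 0"
      using \<phi> by (auto simp: C_c_def)
    have \<phi>': "\<phi> \<in> C_c 1 UNIV"
      using \<phi> by (auto simp: C_c_def)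
    obtain c d m m' where m: "m < 4 * CARD('n)" "m' < 4 * CARD('n)"
        and eq: "\<forall>D. nabla_comb k \<alpha> D = c * D m + d * D m'"
      using nabla_comb_two_terms[OF k, of \<alpha>] by blast
    have int: "integrable lborel (xderiv l \<phi>)" if "l < 4 * CARD('n)" for l
      using C_c_integrable[OF open_UNIV continuous_on_const, of "xderiv l \<phi>" 0 1] C_c_xderiv[of \<phi> 0 UNIV l] \<phi>' that
      by (simp add: set_integrable_def)
    have "nabla k \<alpha> \<phi> q = 0" if "q \<notin> S" for q
      unfolding nabla_def using xderiv_eq_0_outside[OF compact_imp_closed[OF S(1)] S(3) that] by simp
    then have "indicator \<Omega> q *\<^sub>R nabla k \<alpha> \<phi> q = nabla k \<alpha> \<phi> q" for q
      using S(2) by (auto simp: indicator_def)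
    then have "pairing \<Omega> (form_of_fun (\<lambda>_. 1)) (nabla k \<alpha> \<phi>) I = omega {} I * (LINT q|lborel. nabla k \<alpha> \<phi> q)"
      by (simp add: pairing_eq form_of_fun_def set_lebesgue_integral_def)
    also have "(LINT q|lborel. nabla k \<alpha> \<phi> q) = 0"
      using int[OF m(1)] int[OF m(2)] integral_xderiv_eq_0[OF \<phi>' m(1)] integral_xderiv_eq_0[OF \<phi>' m(2)]
      by (simp add: nabla_def eq[rule_format])
    finally show "pairing \<Omega> (form_of_fun (\<lambda>_. 1)) (nabla k \<alpha> \<phi>) I = 0" by simp
  qed
  then show ?thesis
    using 1 by (simp add: weakly_closed_def dist_dform_eq[OF assms 1] ext_wedge_omega_zero)
qed

lemma weakly_closed_wedge_list_triangle:
  assumes "open \<Omega>" "\<And>i. i \<in> set is \<Longrightarrow> C_on 2 \<Omega> (u i)" "\<alpha> \<in> {0, 1}"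
  shows "weakly_closed \<alpha> \<Omega> (wedge_list (map (\<lambda>i. triangle_form (u i)) is))"
  using assms(2)
proof (induction "is")
  case Nil
  then show ?case
    using weakly_closed_one[OF assms(1)] by (simp add: wedge_list_def)
next
  case (Cons i "is")
  then have "weakly_closed \<alpha> \<Omega> (wedge_list (map (\<lambda>i. triangle_form (u i)) is))" "C_on 2 \<Omega> (u i)"
    by auto
  then show ?case
    using assms(1,3) weakly_closed_dform_dform_fun_wedge weakly_closed_dform_dform_fun_wedge_swapped
    by (auto simp: wedge_list_def triangle_form_def simp del: C_on.simps)
qed

text \<open>
  A distribution form enters \<open>dist_dform\<close> only through its values on the partial derivatives of the
  test function; hence identities that hold for test functions can be used inside \<open>dist_dform\<close>.
\<close>

lemma dist_dform_cong:
  fixes S T :: "'n::{finite,linorder} dist_form"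
  assumes "\<And>I m. m < 4 * CARD('n) \<Longrightarrow> S I (xderiv m \<phi>) = T I (xderiv m \<phi>)"
  shows "dist_dform \<alpha> S K \<phi> = dist_dform \<alpha> T K \<phi>"
  unfolding dist_dform_def dist_nabla_def dist_xderiv_def
  using assms by (intro sum.cong refl arg_cong2[where f = "(*)"] nabla_comb_cong[where N = "CARD('n)"]) auto

theorem proposition2p3:
  fixes \<Omega> :: "'n::{finite,linorder} hspace set"
    and u :: "nat \<Rightarrow> 'n hspace \<Rightarrow> complex"
    and n :: nat
  assumes n_def: "n = CARD('n)"
    and domain: "open \<Omega>" "connected \<Omega>" "\<Omega> \<noteq> {}"
    and C2: "\<And>i. i \<in> {1..n} \<Longrightarrow> C_on 2 \<Omega> (u i)"
  shows "let W = wedge_list (map (\<lambda>i. triangle_form (u i)) [2..<Suc n]);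
             L = dist_of_form \<Omega> (wedge_list (map (\<lambda>i. triangle_form (u i)) [1..<Suc n]))
         in dist_form_eq \<Omega> L (dist_dform 0 (dist_of_form \<Omega> (dform 1 (form_of_fun (u 1)) \<and>\<^sub>f W)))
          \<and> dist_form_eq \<Omega> L
              (dist_uminus (dist_dform 1 (dist_of_form \<Omega> (dform 0 (form_of_fun (u 1)) \<and>\<^sub>f W))))
          \<and> dist_form_eq \<Omega> L (dist_dform 0 (dist_dform 1 (dist_of_form \<Omega> (u 1 \<cdot>\<^sub>f W))))
          \<and> dist_form_eq \<Omega> L (dist_triangle (dist_of_form \<Omega> (u 1 \<cdot>\<^sub>f W)))"
proof -
  define W where "W = wedge_list (map (\<lambda>i. triangle_form (u i)) [2..<Suc n])"
  define L where "L = dist_of_form \<Omega> (wedge_list (map (\<lambda>i. triangle_form (u i)) [1..<Suc n]))"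
  have n: "n \<ge> 1"
    using n_def by (simp add: Suc_le_eq)
  have u1: "C_on 2 \<Omega> (u 1)" "C_on 1 \<Omega> (u 1)"
    using C2[of 1] C_on_SucD[of 1 \<Omega> "u 1"] n by (simp_all only: Suc_1 atLeastAtMost_iff le_refl simp_thms)
  have W: "weakly_closed \<alpha> \<Omega> W" if "\<alpha> \<in> {0, 1}" for \<alpha>
    unfolding W_def by (rule weakly_closed_wedge_list_triangle[OF domain(1) _ that]) (use C2 in auto)
  have "[1..<Suc n] = 1 # [2..<Suc n]"
    using n by (simp add: upt_conv_Cons numeral_2_eq_2 del: upt_Suc)
  then have L: "L = dist_of_form \<Omega> (dform 0 (dform 1 (form_of_fun (u 1))) \<and>\<^sub>f W)"
    by (simp add: L_def W_def wedge_list_def triangle_form_def del: upt_Suc)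
  have L': "L K \<phi> = - dist_of_form \<Omega> (dform 1 (dform 0 (form_of_fun (u 1))) \<and>\<^sub>f W) K \<phi>" for K \<phi>
  proof -
    have "L = dist_of_form \<Omega> (\<lambda>q K. - (dform 1 (dform 0 (form_of_fun (u 1))) \<and>\<^sub>f W) q K)"
      unfolding L by (rule dist_of_form_cong) (rule dform_dform_fun_anticommute[OF domain(1) u1(1)])
    then show ?thesis
      by (simp add: dist_of_form_def dist_of_fun_def set_lebesgue_integral_def)
  qed
  have A: "L K \<phi> = dist_dform 0 (dist_of_form \<Omega> (dform 1 (form_of_fun (u 1)) \<and>\<^sub>f W)) K \<phi>"
    if "\<phi> \<in> C_c 2 \<Omega>" for K \<phi>
    unfolding L using that C_c_antimono[of \<phi> 1 \<Omega>]
    by (intro dist_dform_dform_fun_wedge[OF domain(1) u1(1) W, symmetric]) (simp_all only: Suc_1 insert_iff simp_thms)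
  have B: "L K \<phi> = dist_uminus (dist_dform 1 (dist_of_form \<Omega> (dform 0 (form_of_fun (u 1)) \<and>\<^sub>f W))) K \<phi>"
    if "\<phi> \<in> C_c 2 \<Omega>" for K \<phi>
  proof -
    have "\<phi> \<in> C_c 1 \<Omega>" using that C_c_antimono[of \<phi> 1 \<Omega>] by (simp only: Suc_1)
    from dist_dform_dform_fun_wedge[OF domain(1) u1(1) W this, of 1 0 K] show ?thesis
      by (simp add: L' dist_uminus_def)
  qed
  have C: "L K \<phi> = dist_dform 0 (dist_dform 1 (dist_of_form \<Omega> (u 1 \<cdot>\<^sub>f W))) K \<phi>"
    if "\<phi> \<in> C_c 2 \<Omega>" for K \<phi>
    unfolding A[OF that]
  proof (rule dist_dform_cong)
    fix I m assume "m < 4 * CARD('n)"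
    then have "xderiv m \<phi> \<in> C_c 1 \<Omega>"
      using that C_c_xderiv[of \<phi> 1 \<Omega> m] by (simp only: Suc_1)
    from dist_dform_scale[OF domain(1) W u1(2) this, of 1 I]
    show "dist_of_form \<Omega> (dform 1 (form_of_fun (u 1)) \<and>\<^sub>f W) I (xderiv m \<phi>) =
        dist_dform 1 (dist_of_form \<Omega> (u 1 \<cdot>\<^sub>f W)) I (xderiv m \<phi>)"
      by (simp add: dform_fun_wedge[abs_def])
  qed
  show ?thesis
    unfolding Let_def W_def[symmetric] L_def[symmetric] dist_form_eq_def dist_triangle_def
    using A B C test_functions_subset_C_c[of \<Omega> 2] by blast
qed

end
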